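(* Consider $f(x)=\frac1n\sum_{i=1}^n f_i(x)$, $x\in\mathbb{R}^d$. Assume there exists $f_*\in\mathbb{R}$ with $f(x)\ge f_*$ for all $x\in\mathbb{R}^d$; that $f_i$ is $L_i$-smooth for all $i\in\{1,\dots,n\}$, i.e. $\|\nabla f_i(x)-\nabla f_i(y)\|\le L_i\|x-y\|$ for all $x,y\in\mathbb{R}^d$; and that $f$ satisfies the Polyak–Łojasiewicz condition with parameter $\mu$, i.e. $\|\nabla f(x)\|^2\ge2\mu(f(x)-f(x^* ))$ for all $x\in\mathbb{R}^d$, where $x^*=\arg\min_{x\in\mathbb{R}^d}f(x)$. Let $\mathcal{Q}$ be a quantization operator with parameter $\omega$ and expected density $\zeta_{\mathcal Q}$, let $p\in(0,1]$, $r\le n$, and let $$\gamma\le\min\left\{\frac{1}{L\left(1+\sqrt{\frac{2(1-p)(1+\omega)}{pr}}\right)},\frac{p}{2\mu}\right\},\qquad L^2=\frac1n\sum_{i=1}^nL_i^2.$$ Then after $K$ iterations of PP-MARINA we have $$\mathbf{E}\left[f(x^K)-f(x^* )\right]\le(1-\gamma\mu)^K\Delta_0,$$ where $\Delta_0=f(x^0)-f(x^* )$. That is, after $$K=\mathcal{O}\left(\max\left\{\frac1p,\frac L\mu\left(1+\sqrt{\frac{(1-p)(1+\omega)}{pr}}\right)\right\}\log\frac{\Delta_0}{\varepsilon}\right)$$ iterations PP-MARINA produces such a point $x^K$ that $\mathbf{E}[f(x^K)-f(x^* )]\le\varepsilon$. Moreover, under an assumption that the communication cost is proportional to the number of non-zero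 components of transmitted vectors from workers to the server, the expected total communication cost (for all workers) equals $$dn+K(pdn+(1-p)\zeta_{\mathcal Q}r)=\mathcal{O}\left(dn+\max\left\{\frac1p,\frac L\mu\left(1+\sqrt{\frac{(1-p)(1+\omega)}{pr}}\right)\right\}(pdn+(1-p)\zeta_{\mathcal Q}r)\log\frac{\Delta_0}{\varepsilon}\right).$$
   Context: $\|\cdot\|$ is the Euclidean norm; $\|y\|_0$ is the number of non-zero components of $y\in\mathbb{R}^d$. Quantization operator: a stochastic mapping $\mathcal{Q}:\mathbb{R}^d\to\mathbb{R}^d$ for which there is $\omega>0$ with $\mathbf{E}[\mathcal{Q}(x)]=x$ and $\mathbf{E}[\|\mathcal{Q}(x)-x\|^2]\le\omega\|x\|^2$ for any $x\in\mathbb{R}^d$. Its expected density is $\zeta_{\mathcal Q}=\sup_{x\in\mathbb{R}^d}\mathbf{E}[\|\mathcal{Q}(x)\|_0]$. PP-MARINA (a distributed method with $n$ workers, worker $i$ having access to $f_i$, and a server; input: starting point $x^0$, stepsize $\gamma$, probability $p\in(0,1]$, number of iterations $K$, clients-batchsize $r\le n$): initialize $g^0=\nabla f(x^0)$. For $k=0,\dots,K-1$: sample $c_k\sim\mathrm{Bernoulli}(p)$; choose $I'_k=\{1,\dots,n\}$ if $c_k=1$, and choose $I'_k$ as the set of $r$ i.i.d. samples from the uniform distribution over $\{1,\dots,n\}$ otherwise; broadcast $g^k$ to all workers; each worker $i=1,\dots,n$ in parallel computes $x^{k+1}=x^k-\gamma g^k$ and sets $g_i^{k+1}=\nabla f_i(x^{k+1})$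 if $c_k=1$, and $g_i^{k+1}=g^k+\mathcal{Q}(\nabla f_i(x^{k+1})-\nabla f_i(x^k))$ if $c_k=0$; then set $g^{k+1}=\nabla f(x^{k+1})$ if $c_k=1$, and $g^{k+1}=g^k+\frac1r\sum_{i_k\in I'_k}\mathcal{Q}(\nabla f_{i_k}(x^{k+1})-\nabla f_{i_k}(x^k))$ if $c_k=0$. The point considered here is the last iterate $x^K$.
   Formalization: Cost equality is proved charging d per full and ζ_Q per quantized vector; the true non-zero count is at most this, with equality if messages attain these densities (at x^0=x^*, n=1, it is 0). Also γ>0, and O(·) is for ε≤Δ_0/2 at the largest γ; L=0 (bound undefined) excluded. *)

theory Defs
  imports "HOL-Probability.Probability"
begin

definition grad :: "('a::real_inner \<Rightarrow> real) \<Rightarrow> 'a \<Rightarrow> 'a" where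
  "grad f x = (THE D. GDERIV f x :> D)"

definition L_smooth :: "real \<Rightarrow> ('a::real_inner \<Rightarrow> real) \<Rightarrow> bool" where
  "L_smooth L f \<longleftrightarrow>
     (\<forall>x. f differentiable (at x)) \<and>
     (\<forall>x y. norm (grad f x - grad f y) \<le> L * norm (x - y))"

definition polyak_lojasiewicz :: "real \<Rightarrow> ('a::real_inner \<Rightarrow> real) \<Rightarrow> 'a \<Rightarrow> bool" where
  "polyak_lojasiewicz \<mu> f xs \<longleftrightarrow>
     \<mu> > 0 \<and> is_arg_min f (\<lambda>_. True) xs \<and>
     (\<forall>x. (norm (grad f x))\<^sup>2 \<ge> 2 * \<mu> * (f x - f xs))"

definition average :: "nat \<Rightarrow> (nat \<Rightarrow> 'a \<Rightarrow> real) \<Rightarrow> 'a \<Rightarrow> real" where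
  "average n F x = (1 / real n) * (\<Sum>i = 1..n. F i x)"

definition l0 :: "real ^ 'd \<Rightarrow> nat" where
  "l0 y = card {j. y $ j \<noteq> 0}"

(* A stochastic mapping is a Markov kernel: Q x is the law of the random vector Q(x). *)
definition quantization_operator ::
    "real \<Rightarrow> (real ^ 'd \<Rightarrow> (real ^ 'd) measure) \<Rightarrow> bool" where
  "quantization_operator \<omega> Q \<longleftrightarrow>
     \<omega> > 0 \<and> Q \<in> borel \<rightarrow>\<^sub>M prob_algebra borel \<and>
     (\<forall>x. integrable (Q x) (\<lambda>y. y) \<and> (\<integral>y. y \<partial>Q x) = x \<and>
          integrable (Q x) (\<lambda>y. (norm (y - x))\<^sup>2) \<and>
          (\<integral>y. (norm (y - x))\<^sup>2 \<partial>Q x) \<le> \<omega> * (norm x)\<^sup>2)"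

definition expected_density :: "(real ^ 'd \<Rightarrow> (real ^ 'd) measure) \<Rightarrow> real" where
  "expected_density Q = (SUP x. \<integral>y. real (l0 y) \<partial>Q x)"

(* A state (x, g, u, q, z) consists of the iterate x, the gradient estimator g, and three
   counters for what the workers have sent to the server so far: u uncompressed vectors,
   q quantized vectors, and z non-zero components in all these vectors together. *)
type_synonym 'd marina_state = "(real ^ 'd) \<times> (real ^ 'd) \<times> nat \<times> nat \<times> nat"

definition marina_space :: "'d::finite marina_state measure" where
  "marina_space = borel \<Otimes>\<^sub>M borel \<Otimes>\<^sub>M count_space UNIV \<Otimes>\<^sub>M count_space UNIV \<Otimes>\<^sub>M count_space UNIV"

(* The joint law of the sum of r independent messages Q(v i) and of the total number of their
   non-zero components, where every message uses its own index i, uniform on {1..n}, and its own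
   realization of Q. Indices are drawn with replacement, and repetitions count. *)
primrec quantized_sum ::
    "(real ^ 'd \<Rightarrow> (real ^ 'd) measure) \<Rightarrow> nat \<Rightarrow> (nat \<Rightarrow> real ^ 'd) \<Rightarrow> nat \<Rightarrow> ((real ^ 'd) \<times> nat) measure"
  where
    "quantized_sum Q n v 0 = return (borel \<Otimes>\<^sub>M count_space UNIV) (0, 0)"
  | "quantized_sum Q n v (Suc r) = do {
       (s, z) \<leftarrow> quantized_sum Q n v r;
       i \<leftarrow> measure_pmf (pmf_of_set {1..n});
       y \<leftarrow> Q (v i);
       return (borel \<Otimes>\<^sub>M count_space UNIV) (s + y, z + l0 y)
     }"

definition pp_marina_step ::
    "(real ^ 'd \<Rightarrow> (real ^ 'd) measure) \<Rightarrow> (nat \<Rightarrow> real ^ 'd \<Rightarrow> real) \<Rightarrow> nat \<Rightarrow> nat \<Rightarrow> real \<Rightarrow> real \<Rightarrow>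
     'd marina_state \<Rightarrow> 'd marina_state measure" where
  "pp_marina_step Q F n r p \<gamma> = (\<lambda>(x, g, u, q, z). do {
     c \<leftarrow> measure_pmf (bernoulli_pmf p);
     let x' = x - \<gamma> *\<^sub>R g;
     if c then
       return marina_space
         (x', grad (average n F) x', u + n, q, z + (\<Sum>i = 1..n. l0 (grad (F i) x')))
     else do {
       (s, m) \<leftarrow> quantized_sum Q n (\<lambda>i. grad (F i) x' - grad (F i) x) r;
       return marina_space (x', g + (1 / real r) *\<^sub>R s, u, q + r, z + m)
     }
   })"

(* The law of the state after k iterations. Initially every worker sends its full gradient. *)
primrec pp_marina ::
    "(real ^ 'd \<Rightarrow> (real ^ 'd) measure) \<Rightarrow> (nat \<Rightarrow> real ^ 'd \<Rightarrow> real) \<Rightarrow> nat \<Rightarrow> nat \<Rightarrow> real \<Rightarrow> real \<Rightarrow>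
     real ^ 'd \<Rightarrow> nat \<Rightarrow> 'd marina_state measure" where
    "pp_marina Q F n r p \<gamma> x0 0 =
       return marina_space (x0, grad (average n F) x0, n, 0, \<Sum>i = 1..n. l0 (grad (F i) x0))"
  | "pp_marina Q F n r p \<gamma> x0 (Suc k) = pp_marina Q F n r p \<gamma> x0 k \<bind> pp_marina_step Q F n r p \<gamma>"

(* The number of non-zero components, when an uncompressed vector is counted with all its
   CARD('d) components and a quantized vector with the expected density of Q. *)
definition charged_cost :: "(real ^ 'd \<Rightarrow> (real ^ 'd) measure) \<Rightarrow> 'd marina_state \<Rightarrow> real" where
  "charged_cost Q = (\<lambda>(x, g, u, q, z). real CARD('d) * real u + expected_density Q * real q)"

definition nonzero_cost :: "'d marina_state \<Rightarrow> real" where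
  "nonzero_cost = (\<lambda>(x, g, u, q, z). real z)"

(* Every message that can occur in the first K iterations has as many non-zero components
   as it is charged for: exactly if uncompressed, in expectation if quantized. *)
definition density_attained ::
    "(real ^ 'd \<Rightarrow> (real ^ 'd) measure) \<Rightarrow> (nat \<Rightarrow> real ^ 'd \<Rightarrow> real) \<Rightarrow> nat \<Rightarrow> nat \<Rightarrow> real \<Rightarrow> real \<Rightarrow>
     real ^ 'd \<Rightarrow> nat \<Rightarrow> bool" where
  "density_attained Q F n r p \<gamma> x0 K \<longleftrightarrow>
     (\<forall>i\<in>{1..n}. l0 (grad (F i) x0) = CARD('d)) \<and>
     (\<forall>k<K. AE s in pp_marina Q F n r p \<gamma> x0 k. case s of (x, g, _) \<Rightarrow>
        (let x' = x - \<gamma> *\<^sub>R g in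
         \<forall>i\<in>{1..n}. l0 (grad (F i) x') = CARD('d) \<and>
           (\<integral>y. real (l0 y) \<partial>Q (grad (F i) x' - grad (F i) x)) = expected_density Q))"

end

theory Submission
  imports Defs
begin

text \<open>
  The Lyapunov function f x - f xs + \<gamma>/p |g - grad f x|^2 contracts in expectation by the factor
  1 - \<gamma> \<mu> in every step. The descent lemma and the Polyak-Lojasiewicz inequality bound f at the
  new iterate up to the error |g - grad f x|^2 of the gradient estimator and a negative multiple of
  |\<gamma> g|^2. The messages have mean grad f x' - grad f x, so the new error is at most (1 - p) times
  the old one plus a variance of at most (1 - p) (1 + \<omega>) L^2 |\<gamma> g|^2 / r, which the stepsize bound
  absorbs into the negative term. Since the step is a Markov kernel and all quantities are
  nonnegative, expectations are computed as nonnegative integrals, iterated along the kernel,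
  and integrability comes out at the end.
\<close>

section \<open>Smooth functions\<close>

text \<open>The weight \<open>\<gamma> / p\<close> is a balance of accounts. A full round, of
  probability \<open>p\<close>, resets the estimator error, so the weighted error loses
  \<open>\<gamma>\<close> times the squared error per step in expectation. One half of this pays for
  the term \<open>\<gamma> / 2\<close> times the squared error in the inexact descent inequality,
  the other half for the contraction of the error term; the latter is what
  \<open>\<gamma> \<le> p / (2 * \<mu>)\<close> is for. The factor 2 under the root of the other
  stepsize bound offsets the 1/2 in front of the squared norm of \<open>g\<close> in the same
  inequality. As to the cost, the density is a supremum over all inputs, so the mean number of
  non-zero components of a quantized message may be smaller. The exact formula therefore belongs to
  \<open>charged_cost\<close>; for \<open>nonzero_cost\<close> it is an upper bound, and an equality
  if every message attains its charge. Both are counters with a controlled mean increment, so they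
  are iterated along the kernel in the same way.\<close>

lemma GDERIV_imp_grad_eq:
  assumes "GDERIV f x :> D"
  shows "grad f x = D"
  unfolding grad_def
proof (rule the_equality)
  show "GDERIV f x :> D" by (fact assms)
next
  fix E assume "GDERIV f x :> E"
  with assms have "(\<lambda>h. h \<bullet> E) = (\<lambda>h. h \<bullet> D)"
    unfolding gderiv_def by (rule has_derivative_unique[rotated])
  then have "(E - D) \<bullet> E = (E - D) \<bullet> D" by (rule fun_cong)
  then have "(E - D) \<bullet> (E - D) = 0" by (simp add: inner_diff_right)
  then show "E = D" by simp
qed

lemma GDERIV_grad:
  fixes f :: "'a::euclidean_space \<Rightarrow> real"
  assumes "f differentiable (at x)"
  shows "GDERIV f x :> grad f x"
proof -
  from assms obtain D where D: "(f has_derivative D) (at x)"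
    unfolding differentiable_def by blast
  then have "linear D" by (rule has_derivative_linear)
  \<comment> \<open>The vector \<open>adjoint D 1\<close> is the Riesz representative of the
    functional \<open>D\<close>.\<close>
  then have "D = (\<lambda>h. h \<bullet> adjoint D 1)"
    using adjoint_works[of D _ 1] by auto
  with D have "GDERIV f x :> adjoint D 1" unfolding gderiv_def by metis
  then show ?thesis using GDERIV_imp_grad_eq by metis
qed

lemma L_smooth_GDERIV_grad:
  fixes f :: "'a::euclidean_space \<Rightarrow> real"
  shows "L_smooth L f \<Longrightarrow> GDERIV f x :> grad f x"
  unfolding L_smooth_def by (simp add: GDERIV_grad)

lemma L_smooth_norm_grad_diff:
  "L_smooth L f \<Longrightarrow> norm (grad f x - grad f y) \<le> L * norm (x - y)"
  unfolding L_smooth_def by blast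

lemma L_smooth_continuous_grad:
  fixes f :: "'a::euclidean_space \<Rightarrow> real"
  assumes "L_smooth L f"
  shows "continuous_on UNIV (grad f)"
proof -
  \<comment> \<open>\<open>lipschitz_on\<close> demands a nonnegative constant, which
    \<open>L_smooth\<close> does not state; hence the absolute value.\<close>
  have "norm (grad f x - grad f y) \<le> \<bar>L\<bar> * norm (x - y)" for x y
    using L_smooth_norm_grad_diff[OF assms, of x y] abs_ge_self[of L]
    by (meson mult_right_mono norm_ge_zero order_trans)
  then have "\<bar>L\<bar>-lipschitz_on UNIV (grad f)"
    by (auto simp: lipschitz_on_def dist_norm)
  then show ?thesis by (rule lipschitz_on_continuous_on)
qed

lemma L_smooth_continuous:
  fixes f :: "'a::euclidean_space \<Rightarrow> real"
  assumes "L_smooth L f"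
  shows "continuous_on UNIV f"
  using assms unfolding L_smooth_def
  by (simp add: continuous_at_imp_continuous_on differentiable_imp_continuous_within)

lemma L_smooth_descent:
  fixes f :: "'a::euclidean_space \<Rightarrow> real"
  assumes "L_smooth L f"
  shows "f y \<le> f x + grad f x \<bullet> (y - x) + L / 2 * (norm (y - x))\<^sup>2"
proof -
  let ?h = "y - x"
  \<comment> \<open>Deducting the claimed upper bound along the segment from \<open>x\<close> to
    \<open>y\<close> turns the claim into \<open>\<phi> 1 \<le> \<phi> 0\<close>. The sign of the
    derivative yields this without integrating the gradient.\<close>
  define \<phi> where "\<phi> t = f (x + t *\<^sub>R ?h) - t * (grad f x \<bullet> ?h) - L / 2 * (norm ?h)\<^sup>2 * t\<^sup>2" for t
  have "\<exists>D. DERIV \<phi> t :> D \<and> D \<le> 0" if "0 \<le> t" for t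
  proof -
    have "(f has_derivative (\<lambda>h. h \<bullet> grad f (x + t *\<^sub>R ?h))) (at (x + t *\<^sub>R ?h))"
      using L_smooth_GDERIV_grad[OF assms] unfolding gderiv_def .
    then have 1: "((\<lambda>t. f (x + t *\<^sub>R ?h)) has_derivative (\<lambda>s. (s *\<^sub>R ?h) \<bullet> grad f (x + t *\<^sub>R ?h))) (at t)"
      by (rule has_derivative_compose[rotated]) (auto intro!: derivative_eq_intros)
    then have 1: "DERIV (\<lambda>t. f (x + t *\<^sub>R ?h)) t :> ?h \<bullet> grad f (x + t *\<^sub>R ?h)"
      unfolding has_field_derivative_def by (simp add: mult.commute[of _ "_ \<bullet> _"])
    have D: "DERIV \<phi> t :> ?h \<bullet> grad f (x + t *\<^sub>R ?h) - grad f x \<bullet> ?h - L * (norm ?h)\<^sup>2 * t"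
      unfolding \<phi>_def by (rule derivative_eq_intros 1 refl)+ simp
    have "?h \<bullet> grad f (x + t *\<^sub>R ?h) - grad f x \<bullet> ?h = ?h \<bullet> (grad f (x + t *\<^sub>R ?h) - grad f x)"
      by (simp add: inner_diff_right inner_commute)
    also have "\<dots> \<le> norm ?h * norm (grad f (x + t *\<^sub>R ?h) - grad f x)"
      by (rule norm_cauchy_schwarz)
    also have "\<dots> \<le> norm ?h * (L * norm (x + t *\<^sub>R ?h - x))"
      by (intro mult_left_mono L_smooth_norm_grad_diff assms) simp
    also have "\<dots> = L * (norm ?h)\<^sup>2 * t"
      using that by (simp add: power2_eq_square)
    finally show ?thesis using D by fastforce
  qed
  then have "\<phi> 1 \<le> \<phi> 0"
    by (intro DERIV_nonpos_imp_nonincreasing[of 0 1 \<phi>]) auto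
  then show ?thesis by (simp add: \<phi>_def)
qed

lemma GDERIV_average:
  assumes "\<And>i. i \<in> {1..n} \<Longrightarrow> GDERIV (F i) x :> G i"
  shows "GDERIV (average n F) x :> (1 / real n) *\<^sub>R (\<Sum>i = 1..n. G i)"
proof -
  have "((\<lambda>y. (1 / real n) * (\<Sum>i = 1..n. F i y)) has_derivative
      (\<lambda>h. (1 / real n) * (\<Sum>i = 1..n. h \<bullet> G i))) (at x)"
    using assms unfolding gderiv_def
    by (intro has_derivative_mult_right has_derivative_sum) auto
  then show ?thesis
    unfolding gderiv_def average_def[abs_def] by (simp add: inner_sum_right)
qed

text \<open>The source of the mean of squares in \<open>L\<close>: it serves both the smoothness of
  the average and the variance of the messages.\<close>

lemma sum_norm_grad_diff_le:
  assumes "\<And>i. i \<in> {1..n} \<Longrightarrow> L_smooth (Li i) (F i)"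
  shows "(\<Sum>i = 1..n. (norm (grad (F i) x - grad (F i) y))\<^sup>2)
    \<le> (\<Sum>i = 1..n. (Li i)\<^sup>2) * (norm (x - y))\<^sup>2"
  unfolding sum_distrib_right
proof (rule sum_mono)
  fix i assume "i \<in> {1..n}"
  then have "norm (grad (F i) x - grad (F i) y) \<le> Li i * norm (x - y)"
    by (intro L_smooth_norm_grad_diff assms)
  then show "(norm (grad (F i) x - grad (F i) y))\<^sup>2 \<le> (Li i)\<^sup>2 * (norm (x - y))\<^sup>2"
    using power_mono[of _ _ 2] by (fastforce simp: power_mult_distrib)
qed

text \<open>The triangle inequality gives the arithmetic mean of the \<open>Li i\<close> as a
  constant, and Cauchy-Schwarz passes from it to the root mean square, so that one and the same
  \<open>L\<close> governs the descent of the average and the variance of the messages.\<close>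

lemma L_smooth_average:
  fixes F :: "nat \<Rightarrow> 'a::euclidean_space \<Rightarrow> real"
  assumes smooth: "\<And>i. i \<in> {1..n} \<Longrightarrow> L_smooth (Li i) (F i)"
  shows "L_smooth (sqrt ((1 / real n) * (\<Sum>i = 1..n. (Li i)\<^sup>2))) (average n F)"
  unfolding L_smooth_def
proof (intro conjI allI)
  let ?G = "\<lambda>x. (1 / real n) *\<^sub>R (\<Sum>i = 1..n. grad (F i) x)"
  have G: "GDERIV (average n F) x :> ?G x" for x
    by (intro GDERIV_average L_smooth_GDERIV_grad[OF smooth])
  then show "average n F differentiable at x" for x
    unfolding gderiv_def differentiable_def by blast
  fix x y
  have "norm (?G x - ?G y) = (1 / real n) * norm (\<Sum>i = 1..n. grad (F i) x - grad (F i) y)"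
    by (simp add: sum_subtractf flip: scaleR_diff_right)
  then have "(norm (?G x - ?G y))\<^sup>2 = (1 / real n)\<^sup>2 * (norm (\<Sum>i = 1..n. grad (F i) x - grad (F i) y))\<^sup>2"
    by (simp add: power_divide)
  also have "\<dots> \<le> (1 / real n)\<^sup>2 * (\<Sum>i = 1..n. norm (grad (F i) x - grad (F i) y))\<^sup>2"
    by (intro mult_left_mono power_mono norm_sum) auto
  also have "\<dots> \<le> (1 / real n)\<^sup>2 * ((\<Sum>i = 1..n. (norm (grad (F i) x - grad (F i) y))\<^sup>2) * real n)"
    using sum_squared_le_sum_of_squares[of "\<lambda>i. norm (grad (F i) x - grad (F i) y)" "{1..n}"]
    by (intro mult_left_mono) auto
  also have "\<dots> \<le> (1 / real n)\<^sup>2 * ((\<Sum>i = 1..n. (Li i)\<^sup>2) * (norm (x - y))\<^sup>2 * real n)"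
    by (intro mult_left_mono mult_right_mono sum_norm_grad_diff_le[of n Li F, OF smooth]) auto
  also have "\<dots> = (sqrt ((1 / real n) * (\<Sum>i = 1..n. (Li i)\<^sup>2)) * norm (x - y))\<^sup>2"
    by (simp add: power_mult_distrib sum_nonneg power2_eq_square[of "1 / real n"])
  finally have "norm (?G x - ?G y) \<le> sqrt ((1 / real n) * (\<Sum>i = 1..n. (Li i)\<^sup>2)) * norm (x - y)"
    by (rule power2_le_imp_le) (simp add: sum_nonneg)
  then show "norm (grad (average n F) x - grad (average n F) y)
      \<le> sqrt ((1 / real n) * (\<Sum>i = 1..n. (Li i)\<^sup>2)) * norm (x - y)"
    by (simp add: GDERIV_imp_grad_eq[OF G])
qed

text \<open>Fermat's rule. It serves to exclude \<open>L = 0\<close> when the largest admissible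
  stepsize has to be positive.\<close>

lemma grad_arg_min_eq_0:
  fixes f :: "'a::euclidean_space \<Rightarrow> real"
  assumes "f differentiable (at xs)" "is_arg_min f (\<lambda>_. True) xs"
  shows "grad f xs = 0"
proof -
  have "(\<lambda>h. h \<bullet> grad f xs) = (\<lambda>v. 0)"
    using GDERIV_grad[OF assms(1)] assms(2) unfolding gderiv_def
    by (intro differential_zero_maxmin[of xs UNIV f]) (auto simp: is_arg_min_linorder)
  then show ?thesis by (metis inner_eq_zero_iff)
qed

text \<open>With t = \<open>\<gamma> * L\<close> and s = \<open>sqrt A\<close> the stepsize bound
  says that t s is at most 1 - t. Squaring and using that the square of 1 - t is at most 1 - t gives
  the quadratic condition which the Lyapunov argument consumes.\<close>

lemma marina_stepsize_bound:
  fixes A L \<gamma> :: real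
  assumes "0 \<le> A" "0 \<le> L" "0 < \<gamma>" "\<gamma> \<le> 1 / (L * (1 + sqrt A))"
  shows "\<gamma> * L + (\<gamma> * L)\<^sup>2 * A \<le> 1"
proof -
  let ?t = "\<gamma> * L" and ?s = "sqrt A"
  \<comment> \<open>For \<open>L = 0\<close> the quotient is \<open>1 / 0 = 0\<close>, so the bound
    would contradict \<open>0 < \<gamma>\<close>.\<close>
  have "L > 0" using assms by (cases "L = 0") auto
  then have pos: "0 < L * (1 + ?s)" using assms by (intro mult_pos_pos) (auto simp: add_pos_nonneg)
  have t: "?t * (1 + ?s) \<le> 1" using assms pos by (simp add: field_simps)
  have "0 \<le> ?t" "0 \<le> ?s" using assms by auto
  then have "0 \<le> ?t * ?s" by (rule mult_nonneg_nonneg)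
  moreover from t have "?t * ?s \<le> 1 - ?t" by (simp add: algebra_simps)
  ultimately have "?t * ?s \<le> 1 - ?t" "0 \<le> ?t * ?s" "?t \<le> 1" by linarith+
  then have "(?t * ?s)\<^sup>2 \<le> (1 - ?t)\<^sup>2" by (intro power_mono) auto
  also have "\<dots> \<le> 1 - ?t" using \<open>?t \<le> 1\<close> \<open>0 \<le> ?t\<close>
    by (simp add: power2_eq_square mult_left_le)
  finally show ?thesis using assms by (simp add: power_mult_distrib)
qed

text \<open>The descent lemma with the inner product of gradient and estimator rewritten by
  polarization. It holds pointwise, for any vector \<open>g\<close>, so no unbiasedness enters
  here.\<close>

lemma descent_inexact_gradient_step:
  fixes f :: "'a::euclidean_space \<Rightarrow> real"
  assumes "L_smooth L f" "0 < \<gamma>"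
  shows "f (x - \<gamma> *\<^sub>R g) \<le> f x - \<gamma> / 2 * (norm (grad f x))\<^sup>2
    - (\<gamma> / 2) * (1 - \<gamma> * L) * (norm g)\<^sup>2 + \<gamma> / 2 * (norm (g - grad f x))\<^sup>2"
proof -
  have "(norm (g - grad f x))\<^sup>2 = (norm g)\<^sup>2 + (norm (grad f x))\<^sup>2 - 2 * (grad f x \<bullet> g)"
    unfolding power2_norm_eq_inner by (simp add: inner_diff inner_commute)
  then have "\<gamma> / 2 * (norm (g - grad f x))\<^sup>2
      = \<gamma> / 2 * (norm g)\<^sup>2 + \<gamma> / 2 * (norm (grad f x))\<^sup>2 - \<gamma> * (grad f x \<bullet> g)"
    by (simp only:) (simp add: field_simps)
  moreover have "\<gamma> / 2 * (1 - \<gamma> * L) * (norm g)\<^sup>2 = \<gamma> / 2 * (norm g)\<^sup>2 - L / 2 * (\<gamma>\<^sup>2 * (norm g)\<^sup>2)"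
    by (simp add: algebra_simps power2_eq_square diff_divide_distrib)
  moreover have "f (x - \<gamma> *\<^sub>R g) \<le> f x - \<gamma> * (grad f x \<bullet> g) + L / 2 * (\<gamma>\<^sup>2 * (norm g)\<^sup>2)"
    using L_smooth_descent[OF assms(1), of "x - \<gamma> *\<^sub>R g" x] by (simp add: power_mult_distrib)
  ultimately show ?thesis by linarith
qed

text \<open>The deterministic core of the convergence proof: the left-hand side bounds the expected
  Lyapunov value after one step, with \<open>c\<close> standing for
  \<open>(1 + \<omega>) / r\<close>. The facts \<open>1\<close>, \<open>2\<close> and
  \<open>3\<close> settle separately the three terms in play: the function gap, the squared norm of
  \<open>g\<close>, and the estimator error.\<close>

lemma lyapunov_contraction:
  fixes f :: "'a::euclidean_space \<Rightarrow> real"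
  assumes smooth: "L_smooth L f" "0 \<le> L" and pl: "polyak_lojasiewicz \<mu> f xs"
    and p: "0 < p" "p \<le> 1" and c: "0 \<le> c"
    and \<gamma>: "0 < \<gamma>" "\<gamma> \<le> 1 / (L * (1 + sqrt (2 * (1 - p) * c / p)))" "\<gamma> \<le> p / (2 * \<mu>)"
  shows "f (x - \<gamma> *\<^sub>R g) - f xs
      + \<gamma> / p * (1 - p) * ((norm (g - grad f x))\<^sup>2 + c * L\<^sup>2 * (norm (\<gamma> *\<^sub>R g))\<^sup>2)
    \<le> (1 - \<gamma> * \<mu>) * (f x - f xs + \<gamma> / p * (norm (g - grad f x))\<^sup>2)"
proof -
  let ?e = "(norm (g - grad f x))\<^sup>2" and ?G = "(norm g)\<^sup>2"
  \<comment> \<open>Chosen so that the weighted variance term equals \<open>\<gamma> / 2\<close>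
    times the squared norm of \<open>g\<close> times \<open>(\<gamma> * L)\<^sup>2 * A\<close>,
    which has the prefactor of the negative term in the descent inequality.\<close>
  define A where "A = 2 * (1 - p) * c / p"
  have mu: "0 < \<mu>" and PL: "2 * \<mu> * (f x - f xs) \<le> (norm (grad f x))\<^sup>2"
    using pl unfolding polyak_lojasiewicz_def by auto
  have "0 \<le> A" using p c by (simp add: A_def)
  then have st: "\<gamma> * L + (\<gamma> * L)\<^sup>2 * A \<le> 1"
    using marina_stepsize_bound smooth \<gamma> unfolding A_def by blast
  have gm: "\<gamma> * \<mu> \<le> p / 2" using \<gamma> mu by (simp add: field_simps)
  have "\<gamma> / 2 * (2 * \<mu> * (f x - f xs)) \<le> \<gamma> / 2 * (norm (grad f x))\<^sup>2"
    using PL \<gamma> by (intro mult_left_mono) auto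
  then have 1: "\<gamma> * \<mu> * (f x - f xs) \<le> \<gamma> / 2 * (norm (grad f x))\<^sup>2" by simp
  have "\<gamma> / 2 * ?G * (\<gamma> * L + (\<gamma> * L)\<^sup>2 * A) \<le> \<gamma> / 2 * ?G * 1"
    using st \<gamma> by (intro mult_left_mono) auto
  then have 2: "\<gamma> / 2 * ?G * (\<gamma> * L) + \<gamma> / 2 * ?G * ((\<gamma> * L)\<^sup>2 * A) \<le> \<gamma> / 2 * ?G"
    by (simp only: distrib_left mult_1_right)
  have "\<gamma> / p * ?e * (\<gamma> * \<mu>) \<le> \<gamma> / p * ?e * (p / 2)"
    using gm \<gamma> p by (intro mult_left_mono) auto
  also have "\<dots> = \<gamma> / 2 * ?e" using p by (simp add: field_simps)
  finally have 3: "\<gamma> / p * ?e * (\<gamma> * \<mu>) \<le> \<gamma> / 2 * ?e" .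
  have "\<gamma> / p * (1 - p) * (c * L\<^sup>2 * (norm (\<gamma> *\<^sub>R g))\<^sup>2) = \<gamma> / 2 * ?G * ((\<gamma> * L)\<^sup>2 * A)"
    using p by (simp add: A_def power_mult_distrib field_simps)
  moreover have "\<gamma> / p * (1 - p) * ?e = \<gamma> / p * ?e - \<gamma> * ?e"
    using p by (simp add: field_simps)
  ultimately have lhs: "\<gamma> / p * (1 - p) * (?e + c * L\<^sup>2 * (norm (\<gamma> *\<^sub>R g))\<^sup>2)
      = \<gamma> / p * ?e - \<gamma> * ?e + \<gamma> / 2 * ?G * ((\<gamma> * L)\<^sup>2 * A)"
    by (simp only: distrib_left)
  have rhs: "(1 - \<gamma> * \<mu>) * (f x - f xs + \<gamma> / p * ?e)
      = f x - f xs + \<gamma> / p * ?e - \<gamma> * \<mu> * (f x - f xs) - \<gamma> / p * ?e * (\<gamma> * \<mu>)"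
    by (simp add: algebra_simps diff_divide_distrib)
  have "\<gamma> / 2 * (1 - \<gamma> * L) * ?G = \<gamma> / 2 * ?G - \<gamma> / 2 * ?G * (\<gamma> * L)"
    by (simp add: field_simps)
  then show ?thesis
    using descent_inexact_gradient_step[OF smooth(1) \<gamma>(1), of x g] 1 2 3
    unfolding lhs rhs by linarith
qed

text \<open>For a uniform index the vectors \<open>b - m + v i\<close> have mean \<open>b\<close>,
  so their mean square is that of \<open>b\<close> plus a variance, and the variance is at most the
  second moment of \<open>v\<close>. This is the cost of sampling clients, the 1 in
  \<open>1 + \<omega>\<close>.\<close>

lemma sum_norm_sq_centered_le:
  fixes v :: "nat \<Rightarrow> 'a::real_inner"
  assumes "1 \<le> n" and m: "m = (1 / real n) *\<^sub>R (\<Sum>i = 1..n. v i)"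
  shows "(\<Sum>i = 1..n. (norm (b - m + v i))\<^sup>2) \<le> real n * (norm b)\<^sup>2 + (\<Sum>i = 1..n. (norm (v i))\<^sup>2)"
proof -
  have nm: "(\<Sum>i = 1..n. v i) = real n *\<^sub>R m" using assms by simp
  have "(\<Sum>i = 1..n. (norm (b - m + v i))\<^sup>2)
      = (\<Sum>i = 1..n. (norm (b - m))\<^sup>2 + 2 * ((b - m) \<bullet> v i) + (norm (v i))\<^sup>2)"
    unfolding power2_norm_eq_inner
    by (intro sum.cong refl) (simp add: inner_add_left inner_add_right inner_commute)
  also have "\<dots> = real n * (norm (b - m))\<^sup>2 + 2 * ((b - m) \<bullet> (\<Sum>i = 1..n. v i)) + (\<Sum>i = 1..n. (norm (v i))\<^sup>2)"
    by (simp add: sum.distrib inner_sum_right sum_distrib_left)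
  \<comment> \<open>The cross term is a multiple of the inner product of \<open>b - m\<close> with
    \<open>m\<close>; completing the square leaves the squared norm of \<open>b\<close> minus that
    of \<open>m\<close>.\<close>
  also have "\<dots> = real n * ((norm b)\<^sup>2 - (norm m)\<^sup>2) + (\<Sum>i = 1..n. (norm (v i))\<^sup>2)"
    unfolding nm power2_norm_eq_inner by (simp add: inner_diff inner_commute algebra_simps)
  also have "\<dots> \<le> real n * (norm b)\<^sup>2 + (\<Sum>i = 1..n. (norm (v i))\<^sup>2)"
    by (simp add: algebra_simps)
  finally show ?thesis .
qed

section \<open>Sums of quantized messages\<close>

lemma measurable_l0 [measurable]: "l0 \<in> borel \<rightarrow>\<^sub>M count_space UNIV"
proof -
  have "(\<lambda>y::real^'a. \<Sum>j\<in>UNIV. if y $ j = 0 then 0 else 1) \<in> borel \<rightarrow>\<^sub>M count_space (UNIV::nat set)"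
    by measurable
  also have "(\<lambda>y::real^'a. \<Sum>j\<in>UNIV. if y $ j = 0 then 0 else 1::nat) = l0"
    by (simp add: fun_eq_iff l0_def sum.If_cases Compl_eq)
  finally show ?thesis .
qed

lemma bind_message_in_prob_algebra:
  fixes Q :: "real ^ 'd \<Rightarrow> (real ^ 'd) measure"
  assumes [measurable]: "Q \<in> borel \<rightarrow>\<^sub>M prob_algebra borel"
  shows "Q x \<bind> (\<lambda>y. return (borel \<Otimes>\<^sub>M count_space UNIV) (s + y, z + l0 y))
    \<in> space (prob_algebra (borel \<Otimes>\<^sub>M count_space UNIV))"
proof -
  have "(\<lambda>x. Q x \<bind> (\<lambda>y. return (borel \<Otimes>\<^sub>M count_space UNIV) (s + y, z + l0 y)))
    \<in> borel \<rightarrow>\<^sub>M prob_algebra (borel \<Otimes>\<^sub>M count_space UNIV)"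
    by measurable
  from measurable_space[OF this] show ?thesis by simp
qed

text \<open>F is unconstrained outside {1..n}, so measurability in v is available for indices in {1..n} only.\<close>

lemma quantized_sum_cong:
  assumes Q: "Q \<in> borel \<rightarrow>\<^sub>M prob_algebra borel"
    and n: "1 \<le> n"
    and eq: "\<And>i. i \<in> {1..n} \<Longrightarrow> v i = w i"
  shows "quantized_sum Q n v r = quantized_sum Q n w r"
proof (induction r)
  case (Suc r)
  let ?R = "\<lambda>s z y. return (borel \<Otimes>\<^sub>M count_space UNIV) (s + y, z + l0 y)"
  have "Q x \<bind> ?R s z \<in> space (subprob_algebra (borel \<Otimes>\<^sub>M count_space UNIV))" for x s z
    using bind_message_in_prob_algebra[OF Q]
    by (auto simp: space_prob_algebra space_subprob_algebra prob_space_imp_subprob_space)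
  note sp = this
  have *: "measure_pmf (pmf_of_set {1..n}) \<bind> (\<lambda>i. Q (v i) \<bind> ?R s z)
      = measure_pmf (pmf_of_set {1..n}) \<bind> (\<lambda>i. Q (w i) \<bind> ?R s z)" for s z
    using n by (intro bind_measure_pmf_cong[OF sp sp]) (auto simp: eq)
  show ?case by (simp only: quantized_sum.simps Suc *)
qed simp

lemma l0_le_CARD: "l0 (y :: real ^ 'd) \<le> CARD('d)"
  unfolding l0_def by (intro card_mono) auto

text \<open>Over a countable index type, joint measurability of a kernel follows from that of its
  slices. This covers both discrete draws of the method, the coin and the client.\<close>

lemma measurable_bind_discrete:
  fixes p :: "'i::countable pmf"
  assumes "\<And>i. K i \<in> M \<rightarrow>\<^sub>M prob_algebra N"
  shows "(\<lambda>x. measure_pmf p \<bind> (\<lambda>i. K i x)) \<in> M \<rightarrow>\<^sub>M prob_algebra N"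
proof (rule measurable_bind_prob_space2)
  show "(\<lambda>x. measure_pmf p) \<in> M \<rightarrow>\<^sub>M prob_algebra (count_space UNIV)"
    by (intro measurable_const) (auto simp: space_prob_algebra measure_pmf.prob_space_axioms)
  show "(\<lambda>(x, i). K i x) \<in> M \<Otimes>\<^sub>M count_space UNIV \<rightarrow>\<^sub>M prob_algebra N"
    unfolding case_prod_beta
    by (rule measurable_compose_countable[where f = "\<lambda>i x. K i (fst x)"])
      (auto intro: measurable_compose[OF measurable_fst assms])
qed

lemma measurable_quantized_sum:
  fixes Q :: "real ^ 'd \<Rightarrow> (real ^ 'd) measure"
  assumes Q: "Q \<in> borel \<rightarrow>\<^sub>M prob_algebra borel"
    and n: "1 \<le> n"
    and v: "\<And>i. i \<in> {1..n} \<Longrightarrow> v i \<in> M \<rightarrow>\<^sub>M borel"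
  shows "(\<lambda>x. quantized_sum Q n (\<lambda>i. v i x) r) \<in> M \<rightarrow>\<^sub>M prob_algebra (borel \<Otimes>\<^sub>M count_space UNIV)"
proof -
  \<comment> \<open>Padding with zero outside \<open>{1..n}\<close> makes every slice measurable, as
    \<open>measurable_bind_discrete\<close> requires, and the law of the sum does not notice the
    change.\<close>
  define w where "w i = (if i \<in> {1..n} then v i else (\<lambda>x. 0))" for i
  have w[measurable]: "w i \<in> M \<rightarrow>\<^sub>M borel" for i using v by (simp add: w_def)
  note [measurable] = Q
  have "(\<lambda>x. quantized_sum Q n (\<lambda>i. w i x) r) \<in> M \<rightarrow>\<^sub>M prob_algebra (borel \<Otimes>\<^sub>M count_space UNIV)"
  proof (induction r)
    case 0
    show ?case by simp
  next
    case (Suc r)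
    show ?case unfolding quantized_sum.simps case_prod_beta
      by (rule measurable_bind_prob_space2[OF Suc], unfold case_prod_beta)
        (intro measurable_bind_discrete, measurable)
  qed
  also have "(\<lambda>x. quantized_sum Q n (\<lambda>i. w i x) r) = (\<lambda>x. quantized_sum Q n (\<lambda>i. v i x) r)"
    by (intro ext quantized_sum_cong Q n) (simp add: w_def)
  finally show ?thesis .
qed

lemma nn_integral_bind_prob:
  assumes "f \<in> borel_measurable B" "N \<in> M \<rightarrow>\<^sub>M prob_algebra B"
  shows "(\<integral>\<^sup>+x. f x \<partial>(M \<bind> N)) = (\<integral>\<^sup>+x. \<integral>\<^sup>+y. f y \<partial>N x \<partial>M)"
  using assms by (intro nn_integral_bind measurable_prob_algebraD)

lemma prob_space_quantized_sum:
  assumes "Q \<in> borel \<rightarrow>\<^sub>M prob_algebra borel" "1 \<le> n"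
  shows "prob_space (quantized_sum Q n v r)"
    and "sets (quantized_sum Q n v r) = sets (borel \<Otimes>\<^sub>M count_space UNIV)"
proof -
  have "quantized_sum Q n v r \<in> space (prob_algebra (borel \<Otimes>\<^sub>M count_space UNIV))"
    \<comment> \<open>Functions that are constant on a dummy space turn the kernel statement into
      one about a single family \<open>v\<close>.\<close>
    using measurable_space[OF measurable_quantized_sum[OF assms, of "\<lambda>i _. v i" "count_space UNIV"]]
    by simp
  then show "prob_space (quantized_sum Q n v r)"
    and "sets (quantized_sum Q n v r) = sets (borel \<Otimes>\<^sub>M count_space UNIV)"
    by (auto simp: space_prob_algebra)
qed

text \<open>Peels off the last message. Both the second moment and the expected number of non-zero
  components are obtained from this recursion by induction on \<open>r\<close>.\<close>

lemma nn_integral_quantized_sum_Suc: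
  fixes Q :: "real ^ 'd \<Rightarrow> (real ^ 'd) measure"
  assumes Q: "Q \<in> borel \<rightarrow>\<^sub>M prob_algebra borel"
    and n: "1 \<le> n"
    and h: "h \<in> borel_measurable (borel \<Otimes>\<^sub>M count_space UNIV)"
  shows "(\<integral>\<^sup>+t. h t \<partial>quantized_sum Q n v (Suc r))
    = (\<integral>\<^sup>+(s, z). (\<Sum>i = 1..n. \<integral>\<^sup>+y. h (s + y, z + l0 y) \<partial>Q (v i)) / of_nat n \<partial>quantized_sum Q n v r)"
proof -
  note [measurable] = Q h
  note S[measurable_cong] = prob_space_quantized_sum(2)[OF Q n, of v r]
  have Qs[measurable_cong]: "sets (Q x) = sets borel" for x
    using measurable_space[OF Q, of x] by (simp add: space_prob_algebra)
  let ?R = "\<lambda>s z y. return (borel \<Otimes>\<^sub>M count_space UNIV) (s + y, z + l0 y)"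
  let ?K = "\<lambda>(s, z). measure_pmf (pmf_of_set {1..n}) \<bind> (\<lambda>i. Q (v i) \<bind> ?R s z)"
  have K: "?K \<in> quantized_sum Q n v r \<rightarrow>\<^sub>M prob_algebra (borel \<Otimes>\<^sub>M count_space UNIV)"
    unfolding case_prod_beta by (intro measurable_bind_discrete) measurable
  have K1: "(\<lambda>i. Q (v i) \<bind> ?R s z) \<in> measure_pmf (pmf_of_set {1..n}) \<rightarrow>\<^sub>M prob_algebra (borel \<Otimes>\<^sub>M count_space UNIV)"
    for s z using bind_message_in_prob_algebra[OF Q] by simp
  have K2: "?R s z \<in> Q x \<rightarrow>\<^sub>M prob_algebra (borel \<Otimes>\<^sub>M count_space UNIV)" for s z x
    by measurable
  have "(\<integral>\<^sup>+t. h t \<partial>?K (s, z))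
      = (\<integral>\<^sup>+i. (\<integral>\<^sup>+y. (\<integral>\<^sup>+t. h t \<partial>?R s z y) \<partial>Q (v i)) \<partial>measure_pmf (pmf_of_set {1..n}))" for s z
    unfolding prod.case nn_integral_bind_prob[OF h K1] nn_integral_bind_prob[OF h K2] ..
  also have "\<dots> s z = (\<integral>\<^sup>+i. (\<integral>\<^sup>+y. h (s + y, z + l0 y) \<partial>Q (v i)) \<partial>measure_pmf (pmf_of_set {1..n}))" for s z
    by (intro nn_integral_cong nn_integral_return) (auto simp: space_pair_measure h)
  also have "\<dots> s z = (\<Sum>i = 1..n. \<integral>\<^sup>+y. h (s + y, z + l0 y) \<partial>Q (v i)) / of_nat n" for s z
    using n by (subst nn_integral_pmf_of_set) auto
  finally have eq: "(\<integral>\<^sup>+t. h t \<partial>?K (s, z)) = (\<Sum>i = 1..n. \<integral>\<^sup>+y. h (s + y, z + l0 y) \<partial>Q (v i)) / of_nat n" for s z .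
  have "(\<integral>\<^sup>+t. h t \<partial>quantized_sum Q n v (Suc r)) = (\<integral>\<^sup>+w. (\<integral>\<^sup>+t. h t \<partial>?K w) \<partial>quantized_sum Q n v r)"
    unfolding quantized_sum.simps by (rule nn_integral_bind_prob[OF h K])
  also have "\<dots> = (\<integral>\<^sup>+(s, z). (\<integral>\<^sup>+t. h t \<partial>?K (s, z)) \<partial>quantized_sum Q n v r)"
    by (intro nn_integral_cong) (simp split: prod.split)
  finally show ?thesis unfolding eq .
qed

lemma prob_space_kernel:
  assumes "Q \<in> borel \<rightarrow>\<^sub>M prob_algebra borel"
  shows "prob_space (Q x)" "sets (Q x) = sets borel"
  using measurable_space[OF assms, of x] by (auto simp: space_prob_algebra)

text \<open>The bias-variance decomposition around the mean \<open>x\<close> of the quantizer: the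
  cross term integrates to zero, and the variance is controlled by \<open>\<omega>\<close>.\<close>

lemma nn_integral_quantizer_norm_sq:
  assumes Q: "quantization_operator \<omega> Q"
  shows "(\<integral>\<^sup>+y. ennreal ((norm (c + y))\<^sup>2) \<partial>Q x) \<le> ennreal ((norm (c + x))\<^sup>2 + \<omega> * (norm x)\<^sup>2)"
proof -
  have K: "Q \<in> borel \<rightarrow>\<^sub>M prob_algebra borel"
    and i1: "integrable (Q x) (\<lambda>y. y)" and m: "(\<integral>y. y \<partial>Q x) = x"
    and i2: "integrable (Q x) (\<lambda>y. (norm (y - x))\<^sup>2)"
    and var: "(\<integral>y. (norm (y - x))\<^sup>2 \<partial>Q x) \<le> \<omega> * (norm x)\<^sup>2"
    using Q unfolding quantization_operator_def by auto
  interpret prob_space "Q x" by (rule prob_space_kernel[OF K])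
  define b where "b = c + x"
  have i3: "integrable (Q x) (\<lambda>y. 2 * (b \<bullet> (y - x)))"
    using i1 by simp
  have "(\<integral>y. b \<bullet> (y - x) \<partial>Q x) = b \<bullet> ((\<integral>y. y \<partial>Q x) - x)"
    using i1 by (simp add: prob_space)
  then have e3: "(\<integral>y. 2 * (b \<bullet> (y - x)) \<partial>Q x) = 0" by (simp add: m)
  have eq: "(norm (c + y))\<^sup>2 = (norm b)\<^sup>2 + 2 * (b \<bullet> (y - x)) + (norm (y - x))\<^sup>2" for y
    unfolding power2_norm_eq_inner b_def by (simp add: inner_add inner_diff inner_commute)
  have int: "integrable (Q x) (\<lambda>y. (norm (c + y))\<^sup>2)"
    unfolding eq using i2 i3 by auto
  have "(\<integral>y. (norm (c + y))\<^sup>2 \<partial>Q x) = (norm b)\<^sup>2 + (\<integral>y. (norm (y - x))\<^sup>2 \<partial>Q x)"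
    unfolding eq using i2 i3 e3 by (simp add: prob_space)
  then show ?thesis
    using var by (simp add: nn_integral_eq_integral[OF int] ennreal_leI b_def del: ennreal_plus)
qed

lemma nn_integral_add_const:
  assumes "prob_space M" and [measurable]: "f \<in> borel_measurable M"
  shows "(\<integral>\<^sup>+x. f x + c \<partial>M) = (\<integral>\<^sup>+x. f x \<partial>M) + c"
proof -
  interpret prob_space M by fact
  show ?thesis by (simp add: nn_integral_add emeasure_space_1)
qed

lemma ennreal_sum_divide_of_nat:
  assumes "\<And>i. i \<in> {1..n} \<Longrightarrow> 0 \<le> a i" "1 \<le> n"
  shows "(\<Sum>i = 1..n. ennreal (a i)) / of_nat n = ennreal ((1 / real n) * (\<Sum>i = 1..n. a i))"
proof -
  have "0 \<le> (\<Sum>i = 1..n. a i)" using assms by (intro sum_nonneg) auto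
  moreover have "(\<Sum>i = 1..n. ennreal (a i)) = ennreal (\<Sum>i = 1..n. a i)"
    using assms by (intro sum_ennreal) auto
  ultimately show ?thesis using assms
    by (simp add: ennreal_of_nat_eq_real_of_nat divide_ennreal)
qed

text \<open>\<open>m\<close> is the mean of one message, so after centring each independent message
  adds its own variance, and the bound grows linearly in \<open>r\<close>. The offset
  \<open>a\<close> carries the error already present before the messages arrive.\<close>

lemma quantized_sum_second_moment:
  fixes Q :: "real ^ 'd \<Rightarrow> (real ^ 'd) measure"
  assumes Q: "quantization_operator \<omega> Q" and n: "1 \<le> n"
    and m: "m = (1 / real n) *\<^sub>R (\<Sum>i = 1..n. v i)"
  shows "(\<integral>\<^sup>+t. ennreal ((norm (a + fst t - real r *\<^sub>R m))\<^sup>2) \<partial>quantized_sum Q n v r)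
    \<le> ennreal ((norm a)\<^sup>2 + real r * ((1 + \<omega>) / real n * (\<Sum>i = 1..n. (norm (v i))\<^sup>2)))"
proof (induction r)
  case 0
  show ?case by (simp add: nn_integral_return space_pair_measure)
next
  case (Suc r)
  define W where "W = (1 + \<omega>) / real n * (\<Sum>i = 1..n. (norm (v i))\<^sup>2)"
  have K: "Q \<in> borel \<rightarrow>\<^sub>M prob_algebra borel" and om: "\<omega> > 0"
    using Q unfolding quantization_operator_def by auto
  have W0: "0 \<le> W" unfolding W_def using om by (simp add: sum_nonneg)
  note ps = prob_space_quantized_sum[OF K n, of v r]
  note S[measurable_cong] = ps(2)
  have step: "(\<Sum>i = 1..n. \<integral>\<^sup>+y. ennreal ((norm (a + (s + y) - real (Suc r) *\<^sub>R m))\<^sup>2) \<partial>Q (v i)) / of_nat n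
      \<le> ennreal ((norm (a + s - real r *\<^sub>R m))\<^sup>2) + ennreal W" for s
  proof -
    \<comment> \<open>The centred partial sum. The next message \<open>y\<close> changes it to
      \<open>b - m + y\<close>, the form treated by \<open>sum_norm_sq_centered_le\<close>.\<close>
    define b where "b = a + s - real r *\<^sub>R m"
    have eq: "a + (s + y) - real (Suc r) *\<^sub>R m = b - m + y" for y
      by (simp add: b_def algebra_simps)
    have "(\<Sum>i = 1..n. \<integral>\<^sup>+y. ennreal ((norm (b - m + y))\<^sup>2) \<partial>Q (v i)) / of_nat n
        \<le> (\<Sum>i = 1..n. ennreal ((norm (b - m + v i))\<^sup>2 + \<omega> * (norm (v i))\<^sup>2)) / of_nat n"
      by (intro divide_right_mono_ennreal sum_mono nn_integral_quantizer_norm_sq Q)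
    also have "\<dots> = ennreal ((1 / real n) * (\<Sum>i = 1..n. (norm (b - m + v i))\<^sup>2 + \<omega> * (norm (v i))\<^sup>2))"
      using om n by (intro ennreal_sum_divide_of_nat) auto
    \<comment> \<open>The two sources of variance meet: the random client contributes the second
      moment of \<open>v\<close> once, the quantizer \<open>\<omega>\<close> times.\<close>
    also have "\<dots> \<le> ennreal ((1 / real n) * ((real n * (norm b)\<^sup>2 + (\<Sum>i = 1..n. (norm (v i))\<^sup>2))
        + \<omega> * (\<Sum>i = 1..n. (norm (v i))\<^sup>2)))"
      using sum_norm_sq_centered_le[OF n m, of b]
      by (intro ennreal_leI mult_left_mono) (auto simp: sum.distrib sum_distrib_left)
    also have "(1 / real n) * ((real n * (norm b)\<^sup>2 + (\<Sum>i = 1..n. (norm (v i))\<^sup>2))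
        + \<omega> * (\<Sum>i = 1..n. (norm (v i))\<^sup>2)) = (norm b)\<^sup>2 + W"
      using n by (simp add: W_def field_simps)
    also have "ennreal \<dots> = ennreal ((norm b)\<^sup>2) + ennreal W"
      using W0 by simp
    finally show ?thesis unfolding eq b_def[symmetric] .
  qed
  have "(\<integral>\<^sup>+t. ennreal ((norm (a + fst t - real (Suc r) *\<^sub>R m))\<^sup>2) \<partial>quantized_sum Q n v (Suc r))
      \<le> (\<integral>\<^sup>+t. ennreal ((norm (a + fst t - real r *\<^sub>R m))\<^sup>2) + ennreal W \<partial>quantized_sum Q n v r)"
    by (subst nn_integral_quantized_sum_Suc[OF K n])
      (auto intro!: nn_integral_mono step[simplified] simp: case_prod_beta)
  also have "\<dots> = (\<integral>\<^sup>+t. ennreal ((norm (a + fst t - real r *\<^sub>R m))\<^sup>2) \<partial>quantized_sum Q n v r) + ennreal W"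
    by (intro nn_integral_add_const ps) measurable
  also have "\<dots> \<le> ennreal ((norm a)\<^sup>2 + real r * W) + ennreal W"
    using Suc.IH unfolding W_def by (intro add_right_mono)
  also have "\<dots> = ennreal ((norm a)\<^sup>2 + real (Suc r) * W)"
    using W0 by (simp flip: ennreal_plus add: algebra_simps)
  finally show ?case unfolding W_def .
qed

text \<open>The bound of \<open>l0\<close> by the dimension gives integrability, and it bounds the
  set of means from above, which is what makes the real supremum in \<open>expected_density\<close>
  an upper bound.\<close>

lemma nn_integral_l0:
  fixes Q :: "real ^ 'd \<Rightarrow> (real ^ 'd) measure"
  assumes Q: "Q \<in> borel \<rightarrow>\<^sub>M prob_algebra borel"
  shows "(\<integral>\<^sup>+y. ennreal (real (l0 y)) \<partial>Q x) = ennreal (\<integral>y. real (l0 y) \<partial>Q x)"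
    and "0 \<le> (\<integral>y. real (l0 y) \<partial>Q x)"
    and "(\<integral>y. real (l0 y) \<partial>Q x) \<le> expected_density Q"
proof -
  have le: "(\<integral>y. real (l0 y) \<partial>Q x) \<le> real CARD('d)" and
    int: "integrable (Q x) (\<lambda>y. real (l0 y))" for x
  proof -
    interpret prob_space "Q x" by (rule prob_space_kernel[OF Q])
    note prob_space_kernel(2)[OF Q, measurable_cong]
    show *: "integrable (Q x) (\<lambda>y. real (l0 y))"
      by (rule integrable_const_bound[where B = "real CARD('d)"]) (auto simp: l0_le_CARD)
    show "(\<integral>y. real (l0 y) \<partial>Q x) \<le> real CARD('d)"
      by (rule integral_le_const[OF *]) (auto simp: l0_le_CARD)
  qed
  show "(\<integral>\<^sup>+y. ennreal (real (l0 y)) \<partial>Q x) = ennreal (\<integral>y. real (l0 y) \<partial>Q x)"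
    by (rule nn_integral_eq_integral[OF int]) simp
  show "0 \<le> (\<integral>y. real (l0 y) \<partial>Q x)" by simp
  show "(\<integral>y. real (l0 y) \<partial>Q x) \<le> expected_density Q"
    unfolding expected_density_def by (intro cSUP_upper bdd_aboveI2[OF le]) auto
qed

text \<open>Linearity of expectation over the \<open>r\<close> messages. The offset \<open>z\<close>
  plays the counter before the step, so the result applies to a state as it is.\<close>

lemma quantized_sum_nonzeros:
  fixes Q :: "real ^ 'd \<Rightarrow> (real ^ 'd) measure"
  assumes Q: "Q \<in> borel \<rightarrow>\<^sub>M prob_algebra borel" and n: "1 \<le> n"
  shows "(\<integral>\<^sup>+t. ennreal (real (z + snd t)) \<partial>quantized_sum Q n v r)
    = ennreal (real z + real r * ((1 / real n) * (\<Sum>i = 1..n. \<integral>y. real (l0 y) \<partial>Q (v i))))"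
proof (induction r)
  case 0
  show ?case by (simp add: nn_integral_return space_pair_measure)
next
  case (Suc r)
  define D where "D = (1 / real n) * (\<Sum>i = 1..n. \<integral>y. real (l0 y) \<partial>Q (v i))"
  have D0: "0 \<le> D" unfolding D_def by (intro mult_nonneg_nonneg sum_nonneg nn_integral_l0[OF Q]) auto
  note ps = prob_space_quantized_sum[OF Q n, of v r]
  note S[measurable_cong] = ps(2) prob_space_kernel(2)[OF Q]
  have "(\<integral>\<^sup>+y. ennreal (real (z + (w + l0 y))) \<partial>Q x) = ennreal (real (z + w) + (\<integral>y. real (l0 y) \<partial>Q x))" for x w
  proof -
    have "(\<integral>\<^sup>+y. ennreal (real (z + (w + l0 y))) \<partial>Q x) = (\<integral>\<^sup>+y. ennreal (real (l0 y)) + ennreal (real (z + w)) \<partial>Q x)"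
      by (simp flip: ennreal_plus add: algebra_simps)
    also have "\<dots> = ennreal (\<integral>y. real (l0 y) \<partial>Q x) + ennreal (real (z + w))"
      by (subst nn_integral_add_const) (auto simp: prob_space_kernel[OF Q] nn_integral_l0[OF Q])
    finally show ?thesis by (simp flip: ennreal_plus add: algebra_simps)
  qed
  then have "(\<Sum>i = 1..n. \<integral>\<^sup>+y. ennreal (real (z + (w + l0 y))) \<partial>Q (v i)) / of_nat n
      = ennreal ((1 / real n) * (\<Sum>i = 1..n. real (z + w) + (\<integral>y. real (l0 y) \<partial>Q (v i))))" for w
    by (simp only:) (rule ennreal_sum_divide_of_nat[OF _ n], simp)
  also have "\<dots> w = ennreal (real (z + w)) + ennreal D" for w
    using n D0 by (simp flip: ennreal_plus add: D_def sum.distrib field_simps)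
  finally have step: "(\<Sum>i = 1..n. \<integral>\<^sup>+y. ennreal (real (z + (w + l0 y))) \<partial>Q (v i)) / of_nat n
      = ennreal (real (z + w)) + ennreal D" for w .
  have "(\<integral>\<^sup>+t. ennreal (real (z + snd t)) \<partial>quantized_sum Q n v (Suc r))
      = (\<integral>\<^sup>+t. ennreal (real (z + snd t)) + ennreal D \<partial>quantized_sum Q n v r)"
    by (subst nn_integral_quantized_sum_Suc[OF Q n], measurable)
      (intro nn_integral_cong, simp only: case_prod_beta snd_conv step)
  also have "\<dots> = ennreal (real z + real r * D) + ennreal D"
    using Suc unfolding D_def[symmetric] by (subst nn_integral_add_const) (auto intro: ps)
  also have "\<dots> = ennreal (real z + real (Suc r) * D)"
    using D0 by (simp flip: ennreal_plus add: algebra_simps)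
  finally show ?case unfolding D_def .
qed

section \<open>The Markov chain of PP-MARINA\<close>

text \<open>Collects what makes the method a Markov chain with computable cost. The assumptions
  relating the stepsize to smoothness come in a second locale, so the cost formulas are available
  for every \<open>\<gamma>\<close>.\<close>

locale pp_marina_kernel =
  fixes Q :: "real ^ 'd \<Rightarrow> (real ^ 'd) measure" and F :: "nat \<Rightarrow> real ^ 'd \<Rightarrow> real"
    and n r :: nat and p \<gamma> :: real
  assumes Q_kernel: "Q \<in> borel \<rightarrow>\<^sub>M prob_algebra borel"
    and n_pos: "1 \<le> n" and r_pos: "1 \<le> r"
    and p_pos: "0 < p" and p_le_1: "p \<le> 1"
    and measurable_grad: "\<And>i. i \<in> {1..n} \<Longrightarrow> grad (F i) \<in> borel_measurable borel"
    and measurable_grad_average [measurable]: "grad (average n F) \<in> borel_measurable borel"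
begin

abbreviation "step \<equiv> pp_marina_step Q F n r p \<gamma>"

abbreviation "law \<equiv> pp_marina Q F n r p \<gamma>"

text \<open>The step is factored into the coin, the random messages and two deterministic updates,
  so that measurability and integrals can be handled piece by piece.\<close>

definition full_update :: "'d marina_state \<Rightarrow> 'd marina_state" where
  "full_update = (\<lambda>(x, g, u, q, z). let x' = x - \<gamma> *\<^sub>R g in
     (x', grad (average n F) x', u + n, q, z + (\<Sum>i = 1..n. l0 (grad (F i) x'))))"

definition messages :: "'d marina_state \<Rightarrow> ((real ^ 'd) \<times> nat) measure" where
  "messages = (\<lambda>(x, g, _). quantized_sum Q n (\<lambda>i. grad (F i) (x - \<gamma> *\<^sub>R g) - grad (F i) x) r)"

definition quantized_update :: "'d marina_state \<Rightarrow> (real ^ 'd) \<times> nat \<Rightarrow> 'd marina_state" where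
  "quantized_update = (\<lambda>(x, g, u, q, z) (s, m). (x - \<gamma> *\<^sub>R g, g + (1 / real r) *\<^sub>R s, u, q + r, z + m))"

lemma step_eq:
  "step s = measure_pmf (bernoulli_pmf p) \<bind> (\<lambda>c. if c then return marina_space (full_update s)
     else messages s \<bind> (\<lambda>t. return marina_space (quantized_update s t)))"
  by (cases s) (simp add: pp_marina_step_def full_update_def messages_def quantized_update_def
      Let_def case_prod_unfold cong: if_cong)

lemma measurable_full_update [measurable]: "full_update \<in> marina_space \<rightarrow>\<^sub>M marina_space"
proof -
  have [measurable]: "(\<lambda>x. \<Sum>i = 1..n. l0 (grad (F i) x)) \<in> borel \<rightarrow>\<^sub>M count_space UNIV"
    by (intro measurable_sum_nat measurable_compose[OF measurable_grad measurable_l0])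
  show ?thesis
    unfolding full_update_def marina_space_def case_prod_beta Let_def by measurable
qed

lemma measurable_messages [measurable]:
  "messages \<in> marina_space \<rightarrow>\<^sub>M prob_algebra (borel \<Otimes>\<^sub>M count_space UNIV)"
  unfolding messages_def case_prod_beta
proof (intro measurable_quantized_sum Q_kernel n_pos)
  fix i assume "i \<in> {1..n}"
  note [measurable] = measurable_grad[OF this]
  show "(\<lambda>s. grad (F i) (fst s - \<gamma> *\<^sub>R fst (snd s)) - grad (F i) (fst s)) \<in> borel_measurable marina_space"
    unfolding marina_space_def by measurable
qed

lemma measurable_quantized_update [measurable]:
  "(\<lambda>(s, t). quantized_update s t) \<in> marina_space \<Otimes>\<^sub>M (borel \<Otimes>\<^sub>M count_space UNIV) \<rightarrow>\<^sub>M marina_space"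
  unfolding quantized_update_def marina_space_def case_prod_beta by measurable

lemma space_marina_space [simp]: "space marina_space = UNIV"
  by (simp add: marina_space_def space_pair_measure)

lemma measurable_quantized_branch [measurable]:
  "(\<lambda>s. messages s \<bind> (\<lambda>t. return marina_space (quantized_update s t)))
    \<in> marina_space \<rightarrow>\<^sub>M prob_algebra marina_space"
  by measurable

lemma measurable_step: "step \<in> marina_space \<rightarrow>\<^sub>M prob_algebra marina_space"
proof -
  have "(\<lambda>s. if c then return marina_space (full_update s)
     else messages s \<bind> (\<lambda>t. return marina_space (quantized_update s t)))
    \<in> marina_space \<rightarrow>\<^sub>M prob_algebra marina_space" for c
    by (cases c; simp only: if_True if_False; measurable)
  then show ?thesis unfolding step_eq[abs_def] by (rule measurable_bind_discrete)
qed

lemma messages_prob: "prob_space (messages s)" "sets (messages s) = sets (borel \<Otimes>\<^sub>M count_space UNIV)"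
  using measurable_space[OF measurable_messages, of s] by (auto simp: space_prob_algebra)

text \<open>Conditioning on the coin. The one-step statements for both costs and for the Lyapunov
  function all start from this formula.\<close>

lemma nn_integral_step:
  assumes h: "h \<in> borel_measurable marina_space"
  shows "(\<integral>\<^sup>+s'. h s' \<partial>step s) = ennreal p * h (full_update s)
    + ennreal (1 - p) * (\<integral>\<^sup>+t. h (quantized_update s t) \<partial>messages s)"
proof -
  have K2: "(\<lambda>t. return marina_space (quantized_update s t)) \<in> messages s \<rightarrow>\<^sub>M prob_algebra marina_space"
    unfolding measurable_cong_sets[OF messages_prob(2) refl]
    using measurable_compose[OF measurable_Pair1' measurable_compose[OF measurable_quantized_update measurable_return_prob_space]]
    by simp
  have K1: "(\<lambda>c. if c then return marina_space (full_update s)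
     else messages s \<bind> (\<lambda>t. return marina_space (quantized_update s t)))
     \<in> measure_pmf (bernoulli_pmf p) \<rightarrow>\<^sub>M prob_algebra marina_space"
    using measurable_space[OF measurable_quantized_branch, of s]
      measurable_space[OF measurable_return_prob_space, of "full_update s" marina_space] by simp
  have "(\<integral>\<^sup>+s'. h s' \<partial>(messages s \<bind> (\<lambda>t. return marina_space (quantized_update s t))))
      = (\<integral>\<^sup>+t. h (quantized_update s t) \<partial>messages s)"
    unfolding nn_integral_bind_prob[OF h K2]
    by (intro nn_integral_cong nn_integral_return h) simp
  then show ?thesis
    unfolding step_eq nn_integral_bind_prob[OF h K1]
    using p_pos p_le_1 by (simp add: nn_integral_return h mult.commute)
qed

lemma law_in_prob_algebra: "law x0 k \<in> space (prob_algebra marina_space)"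
proof (induction k)
  case 0
  then show ?case
    using measurable_space[OF measurable_return_prob_space, of _ marina_space] by simp
next
  case (Suc k)
  then show ?case
    using measurable_space[OF measurable_bind_prob_space[OF measurable_ident measurable_step]] by simp
qed

lemma law_prob: "prob_space (law x0 k)" "sets (law x0 k) = sets marina_space"
  using law_in_prob_algebra[of x0 k] by (auto simp: space_prob_algebra)

section \<open>Iterating one-step estimates along the chain\<close>

lemma nn_integral_law_Suc:
  assumes "h \<in> borel_measurable marina_space"
  shows "(\<integral>\<^sup>+s. h s \<partial>law x0 (Suc k)) = (\<integral>\<^sup>+s. (\<integral>\<^sup>+s'. h s' \<partial>step s) \<partial>law x0 k)"
  unfolding pp_marina.simps
  by (intro nn_integral_bind_prob[OF assms])
    (simp add: measurable_cong_sets[OF law_prob(2) refl] measurable_step)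

lemma nn_integral_law_geometric:
  assumes h: "h \<in> borel_measurable marina_space"
    and step: "\<And>s. (\<integral>\<^sup>+s'. h s' \<partial>step s) \<le> c * h s"
  shows "(\<integral>\<^sup>+s. h s \<partial>law x0 k)
    \<le> c ^ k * h (x0, grad (average n F) x0, n, 0, \<Sum>i = 1..n. l0 (grad (F i) x0))"
proof (induction k)
  case 0
  show ?case by (simp add: nn_integral_return h)
next
  case (Suc k)
  have "(\<integral>\<^sup>+s. h s \<partial>law x0 (Suc k)) \<le> (\<integral>\<^sup>+s. c * h s \<partial>law x0 k)"
    unfolding nn_integral_law_Suc[OF h] by (intro nn_integral_mono step)
  also have "\<dots> = c * (\<integral>\<^sup>+s. h s \<partial>law x0 k)"
    by (intro nn_integral_cmult) (simp add: measurable_cong_sets[OF law_prob(2) refl] h)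
  also have "\<dots> \<le> c * (c ^ k * h (x0, grad (average n F) x0, n, 0, \<Sum>i = 1..n. l0 (grad (F i) x0)))"
    by (intro mult_left_mono Suc) simp
  finally show ?case by (simp add: mult.assoc)
qed

text \<open>The increment is prescribed only almost everywhere and only for \<open>k < K\<close>,
  because \<open>density_attained\<close> provides no more.\<close>

lemma nn_integral_law_additive:
  assumes h: "h \<in> borel_measurable marina_space" and c: "0 \<le> c"
    and step: "\<And>k. k < K \<Longrightarrow> AE s in law x0 k. (\<integral>\<^sup>+s'. h s' \<partial>step s) = h s + ennreal c"
  shows "(\<integral>\<^sup>+s. h s \<partial>law x0 K)
    = h (x0, grad (average n F) x0, n, 0, \<Sum>i = 1..n. l0 (grad (F i) x0)) + ennreal (real K * c)"
  \<comment> \<open>Chained into the induction so that the range \<open>k < K\<close> of the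
    condition shrinks together with \<open>K\<close>.\<close>
  using step
proof (induction K)
  case 0
  show ?case by (simp add: nn_integral_return h)
next
  case (Suc k)
  have "(\<integral>\<^sup>+s. h s \<partial>law x0 (Suc k)) = (\<integral>\<^sup>+s. h s + ennreal c \<partial>law x0 k)"
    unfolding nn_integral_law_Suc[OF h] by (intro nn_integral_cong_AE Suc.prems) simp
  also have "\<dots> = (\<integral>\<^sup>+s. h s \<partial>law x0 k) + ennreal c"
    by (intro nn_integral_add_const law_prob)
      (simp add: measurable_cong_sets[OF law_prob(2) refl] h)
  also have "(\<integral>\<^sup>+s. h s \<partial>law x0 k)
      = h (x0, grad (average n F) x0, n, 0, \<Sum>i = 1..n. l0 (grad (F i) x0)) + ennreal (real k * c)"
    by (intro Suc.IH Suc.prems) simp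
  also have "\<dots> + ennreal c = h (x0, grad (average n F) x0, n, 0, \<Sum>i = 1..n. l0 (grad (F i) x0))
      + (ennreal (real k * c) + ennreal c)"
    by (rule add.assoc)
  also have "ennreal (real k * c) + ennreal c = ennreal (real (Suc k) * c)"
    using c by (simp add: distrib_right flip: ennreal_plus)
  finally show ?case .
qed

text \<open>Serves the bound on \<open>nonzero_cost\<close> that is claimed for every input, where
  the mean increment depends on the state and only its upper bound is constant.\<close>

lemma nn_integral_law_subadditive:
  assumes h: "h \<in> borel_measurable marina_space" and c: "0 \<le> c"
    and step: "\<And>s. (\<integral>\<^sup>+s'. h s' \<partial>step s) \<le> h s + ennreal c"
  shows "(\<integral>\<^sup>+s. h s \<partial>law x0 K)
    \<le> h (x0, grad (average n F) x0, n, 0, \<Sum>i = 1..n. l0 (grad (F i) x0)) + ennreal (real K * c)"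
proof (induction K)
  case 0
  show ?case by (simp add: nn_integral_return h)
next
  case (Suc k)
  have "(\<integral>\<^sup>+s. h s \<partial>law x0 (Suc k)) \<le> (\<integral>\<^sup>+s. h s + ennreal c \<partial>law x0 k)"
    unfolding nn_integral_law_Suc[OF h] by (intro nn_integral_mono step)
  also have "\<dots> = (\<integral>\<^sup>+s. h s \<partial>law x0 k) + ennreal c"
    by (intro nn_integral_add_const law_prob)
      (simp add: measurable_cong_sets[OF law_prob(2) refl] h)
  also have "\<dots> \<le> h (x0, grad (average n F) x0, n, 0, \<Sum>i = 1..n. l0 (grad (F i) x0))
      + ennreal (real k * c) + ennreal c"
    by (intro add_right_mono Suc.IH)
  also have "\<dots> = h (x0, grad (average n F) x0, n, 0, \<Sum>i = 1..n. l0 (grad (F i) x0))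
      + (ennreal (real k * c) + ennreal c)"
    by (rule add.assoc)
  also have "ennreal (real k * c) + ennreal c = ennreal (real (Suc k) * c)"
    using c by (simp add: distrib_right flip: ennreal_plus)
  finally show ?case .
qed

section \<open>Expected communication cost\<close>

lemma expected_density_nonneg: "0 \<le> expected_density Q"
  using nn_integral_l0(2,3)[OF Q_kernel] order_trans by blast

lemma measurable_charged_cost [measurable]: "charged_cost Q \<in> borel_measurable marina_space"
  unfolding charged_cost_def marina_space_def case_prod_beta by measurable

lemma measurable_nonzero_cost [measurable]: "nonzero_cost \<in> borel_measurable marina_space"
  unfolding nonzero_cost_def marina_space_def case_prod_beta by measurable

text \<open>Once the coin is known the charge is deterministic: all \<open>n\<close> full vectors,
  or \<open>r\<close> messages at the expected density. Hence the mean increment does not depend on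
  the state.\<close>

lemma nn_integral_step_charged_cost:
  "(\<integral>\<^sup>+s'. ennreal (charged_cost Q s') \<partial>step s)
    = ennreal (charged_cost Q s) + ennreal (p * CARD('d) * n + (1 - p) * expected_density Q * r)"
proof -
  note z = expected_density_nonneg
  have c0: "0 \<le> charged_cost Q s" using z by (auto simp: charged_cost_def split: prod.split)
  have full: "charged_cost Q (full_update s) = charged_cost Q s + real CARD('d) * n"
    by (simp add: charged_cost_def full_update_def Let_def split: prod.split) (simp add: algebra_simps)
  have quant: "charged_cost Q (quantized_update s t) = charged_cost Q s + expected_density Q * r" for t
    by (simp add: charged_cost_def quantized_update_def split: prod.split) (simp add: algebra_simps)
  interpret M: prob_space "messages s" by (rule messages_prob)
  show ?thesis
    using p_pos p_le_1 z c0
    by (subst nn_integral_step)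
      (auto simp: full quant M.emeasure_space_1 simp flip: ennreal_plus ennreal_mult,
        simp add: algebra_simps)
qed

text \<open>The conditional mean, given the state, of the growth of the non-zero counter in the next
  step.\<close>

definition expected_nonzeros :: "'d marina_state \<Rightarrow> real" where
  "expected_nonzeros = (\<lambda>(x, g, _). let x' = x - \<gamma> *\<^sub>R g in
     p * (\<Sum>i = 1..n. real (l0 (grad (F i) x')))
     + (1 - p) * (real r * ((1 / real n) * (\<Sum>i = 1..n. \<integral>y. real (l0 y) \<partial>Q (grad (F i) x' - grad (F i) x)))))"

lemma nn_integral_step_nonzero_cost:
  "(\<integral>\<^sup>+s'. ennreal (nonzero_cost s') \<partial>step s) = ennreal (nonzero_cost s) + ennreal (expected_nonzeros s)"
proof -
  obtain x g u q z where s: "s = (x, g, u, q, z)" by (cases s)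
  define D where "D = real r * ((1 / real n) * (\<Sum>i = 1..n. \<integral>y. real (l0 y) \<partial>Q (grad (F i) (x - \<gamma> *\<^sub>R g) - grad (F i) x)))"
  define S where "S = (\<Sum>i = 1..n. real (l0 (grad (F i) (x - \<gamma> *\<^sub>R g))))"
  have D0: "0 \<le> D" unfolding D_def by (intro mult_nonneg_nonneg sum_nonneg nn_integral_l0[OF Q_kernel]) auto
  have S0: "0 \<le> S" unfolding S_def by (intro sum_nonneg) auto
  have nz: "nonzero_cost s = real z" by (simp add: s nonzero_cost_def)
  have inc: "expected_nonzeros s = p * S + (1 - p) * D"
    by (simp add: s expected_nonzeros_def Let_def D_def S_def)
  have full: "nonzero_cost (full_update s) = real z + S"
    by (simp add: s nonzero_cost_def full_update_def Let_def S_def)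
  have quant: "(\<integral>\<^sup>+t. ennreal (nonzero_cost (quantized_update s t)) \<partial>messages s) = ennreal (real z + D)"
    unfolding D_def quantized_sum_nonzeros[OF Q_kernel n_pos, where z = z, symmetric]
    by (simp add: s messages_def nonzero_cost_def quantized_update_def case_prod_beta)
  have "(\<integral>\<^sup>+s'. ennreal (nonzero_cost s') \<partial>step s) = ennreal p * ennreal (real z + S) + ennreal (1 - p) * ennreal (real z + D)"
    by (subst nn_integral_step) (simp_all add: full quant)
  also have "\<dots> = ennreal (p * (real z + S) + (1 - p) * (real z + D))"
    using p_pos p_le_1 D0 S0 by (simp flip: ennreal_plus ennreal_mult)
  also have "p * (real z + S) + (1 - p) * (real z + D) = real z + (p * S + (1 - p) * D)"
    by (simp add: algebra_simps)
  also have "ennreal \<dots> = ennreal (real z) + ennreal (p * S + (1 - p) * D)"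
    using p_pos p_le_1 D0 S0 by simp
  finally show ?thesis unfolding nz inc .
qed

lemma expected_nonzeros_le:
  "expected_nonzeros s \<le> p * CARD('d) * n + (1 - p) * expected_density Q * r"
proof -
  obtain x g u q z where s: "s = (x, g, u, q, z)" by (cases s)
  have "(\<Sum>i = 1..n. real (l0 (grad (F i) (x - \<gamma> *\<^sub>R g)))) \<le> (\<Sum>i = 1..n. real CARD('d))"
    by (intro sum_mono) (simp add: l0_le_CARD)
  then have 1: "p * (\<Sum>i = 1..n. real (l0 (grad (F i) (x - \<gamma> *\<^sub>R g)))) \<le> p * (real n * CARD('d))"
    using p_pos by (intro mult_left_mono) auto
  have "(\<Sum>i = 1..n. \<integral>y. real (l0 y) \<partial>Q (grad (F i) (x - \<gamma> *\<^sub>R g) - grad (F i) x)) \<le> (\<Sum>i = 1..n. expected_density Q)"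
    by (intro sum_mono nn_integral_l0 Q_kernel)
  then have "(1 / real n) * (\<Sum>i = 1..n. \<integral>y. real (l0 y) \<partial>Q (grad (F i) (x - \<gamma> *\<^sub>R g) - grad (F i) x)) \<le> expected_density Q"
    using n_pos by (simp add: field_simps)
  then have "(1 - p) * (real r * ((1 / real n) * (\<Sum>i = 1..n. \<integral>y. real (l0 y) \<partial>Q (grad (F i) (x - \<gamma> *\<^sub>R g) - grad (F i) x))))
      \<le> (1 - p) * (real r * expected_density Q)"
    using p_le_1 by (intro mult_left_mono) auto
  with 1 show ?thesis by (simp add: s expected_nonzeros_def Let_def mult.commute mult.left_commute)
qed

text \<open>A constant mean increment adds up over the \<open>K\<close> steps; the first summand is
  the initial round of full gradients.\<close>

lemma charged_cost_law:
  "has_bochner_integral (law x0 K) (charged_cost Q)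
    (real CARD('d) * n + K * (p * CARD('d) * n + (1 - p) * expected_density Q * r))"
proof (rule has_bochner_integral_nn_integral)
  let ?c = "p * CARD('d) * n + (1 - p) * expected_density Q * r"
  have c: "0 \<le> ?c" using p_pos p_le_1 expected_density_nonneg by simp
  show "charged_cost Q \<in> borel_measurable (law x0 K)"
    by (simp add: measurable_cong_sets[OF law_prob(2) refl])
  show "AE s in law x0 K. 0 \<le> charged_cost Q s"
    using expected_density_nonneg by (auto simp: charged_cost_def split: prod.split)
  show "0 \<le> real CARD('d) * n + K * ?c" using c by simp
  have "(\<integral>\<^sup>+s. ennreal (charged_cost Q s) \<partial>law x0 K)
      = ennreal (charged_cost Q (x0, grad (average n F) x0, n, 0, \<Sum>i = 1..n. l0 (grad (F i) x0))) + ennreal (K * ?c)"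
    by (intro nn_integral_law_additive c) (simp_all add: nn_integral_step_charged_cost)
  also have "\<dots> = ennreal (real CARD('d) * n + K * ?c)"
    using c by (simp add: charged_cost_def)
  finally show "(\<integral>\<^sup>+s. ennreal (charged_cost Q s) \<partial>law x0 K) = ennreal (real CARD('d) * n + K * ?c)" .
qed

text \<open>No vector has more than \<open>CARD('d)\<close> non-zero components and no quantized
  message exceeds the expected density in mean, so the true count stays below the charge in
  expectation. Under \<open>density_attained\<close> both comparisons are tight along almost every
  trajectory.\<close>

lemma nonzero_cost_law:
  shows "integrable (law x0 K) nonzero_cost"
    and "(\<integral>s. nonzero_cost s \<partial>law x0 K)
      \<le> real CARD('d) * n + K * (p * CARD('d) * n + (1 - p) * expected_density Q * r)"
    and "density_attained Q F n r p \<gamma> x0 K \<Longrightarrow> (\<integral>s. nonzero_cost s \<partial>law x0 K)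
      = real CARD('d) * n + K * (p * CARD('d) * n + (1 - p) * expected_density Q * r)"
proof -
  let ?c = "p * CARD('d) * n + (1 - p) * expected_density Q * r"
  have c: "0 \<le> ?c" using p_pos p_le_1 expected_density_nonneg by simp
  have m: "nonzero_cost \<in> borel_measurable (law x0 K)"
    by (simp add: measurable_cong_sets[OF law_prob(2) refl])
  have nn: "0 \<le> nonzero_cost s" for s :: "'d marina_state" by (auto simp: nonzero_cost_def split: prod.split)
  have "(\<integral>\<^sup>+s. ennreal (nonzero_cost s) \<partial>law x0 K)
      \<le> ennreal (real (\<Sum>i = 1..n. l0 (grad (F i) x0))) + ennreal (K * ?c)"
    using nn_integral_law_subadditive[OF _ c, of "\<lambda>s. ennreal (nonzero_cost s)"]
    by (simp add: nn_integral_step_nonzero_cost expected_nonzeros_le ennreal_leI add_left_mono)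
      (simp add: nonzero_cost_def)
  also have "\<dots> \<le> ennreal (real CARD('d) * n) + ennreal (K * ?c)"
  proof (intro add_right_mono ennreal_leI)
    have "(\<Sum>i = 1..n. real (l0 (grad (F i) x0))) \<le> (\<Sum>i = 1..n. real CARD('d))"
      by (intro sum_mono) (simp add: l0_le_CARD)
    then show "real (\<Sum>i = 1..n. l0 (grad (F i) x0)) \<le> real CARD('d) * n"
      by (simp add: mult.commute)
  qed
  also have "\<dots> = ennreal (real CARD('d) * n + K * ?c)" using c by simp
  finally have le: "(\<integral>\<^sup>+s. ennreal (nonzero_cost s) \<partial>law x0 K) \<le> ennreal (real CARD('d) * n + K * ?c)" .
  then show int: "integrable (law x0 K) nonzero_cost"
    by (intro integrableI_nonneg m AE_I2 nn) (auto simp: ennreal_less_top intro: order.strict_trans1)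
  show "(\<integral>s. nonzero_cost s \<partial>law x0 K) \<le> real CARD('d) * n + K * ?c"
    using le c unfolding nn_integral_eq_integral[OF int AE_I2[OF nn]]
    by (subst (asm) ennreal_le_iff) auto
  assume att: "density_attained Q F n r p \<gamma> x0 K"
  have "AE s in law x0 k. (\<integral>\<^sup>+s'. ennreal (nonzero_cost s') \<partial>step s) = ennreal (nonzero_cost s) + ennreal ?c"
    if "k < K" for k
  proof -
    have "AE s in law x0 k. case s of (x, g, _) \<Rightarrow>
        (let x' = x - \<gamma> *\<^sub>R g in
         \<forall>i\<in>{1..n}. l0 (grad (F i) x') = CARD('d) \<and>
           (\<integral>y. real (l0 y) \<partial>Q (grad (F i) x' - grad (F i) x)) = expected_density Q)"
      using att that unfolding density_attained_def by blast
    then show ?thesis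
    proof eventually_elim
      case (elim s)
      then have "expected_nonzeros s = ?c"
        using n_pos by (cases s) (simp add: expected_nonzeros_def Let_def)
      then show ?case by (simp only: nn_integral_step_nonzero_cost)
    qed
  qed
  then have "(\<integral>\<^sup>+s. ennreal (nonzero_cost s) \<partial>law x0 K)
      = ennreal (nonzero_cost (x0, grad (average n F) x0, n, 0, \<Sum>i = 1..n. l0 (grad (F i) x0))) + ennreal (K * ?c)"
    by (intro nn_integral_law_additive c) simp_all
  also have "nonzero_cost (x0, grad (average n F) x0, n, 0, \<Sum>i = 1..n. l0 (grad (F i) x0))
      = real (\<Sum>i = 1..n. l0 (grad (F i) x0))"
    by (simp add: nonzero_cost_def)
  also have "(\<Sum>i = 1..n. l0 (grad (F i) x0)) = CARD('d) * n"
    using att by (simp add: density_attained_def)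
  also have "ennreal (real (CARD('d) * n)) + ennreal (K * ?c) = ennreal (real CARD('d) * n + K * ?c)"
    using c by simp
  finally show "(\<integral>s. nonzero_cost s \<partial>law x0 K) = real CARD('d) * n + K * ?c"
    using c nn unfolding nn_integral_eq_integral[OF int AE_I2[OF nn]]
    by (subst (asm) ennreal_inj) auto
qed

end

section \<open>Convergence\<close>

locale pp_marina_pl = pp_marina_kernel Q F n r p \<gamma>
  for Q :: "real ^ 'd \<Rightarrow> (real ^ 'd) measure" and F n r p \<gamma> +
  fixes \<omega> \<mu> L :: real and Li :: "nat \<Rightarrow> real" and xs :: "real ^ 'd"
  assumes quantizer: "quantization_operator \<omega> Q"
    and smooth: "\<And>i. i \<in> {1..n} \<Longrightarrow> L_smooth (Li i) (F i)"
    and pl: "polyak_lojasiewicz \<mu> (average n F) xs"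
    and L_eq: "L = sqrt ((1 / real n) * (\<Sum>i = 1..n. (Li i)\<^sup>2))"
    and stepsize_pos: "0 < \<gamma>"
    and stepsize: "\<gamma> \<le> 1 / (L * (1 + sqrt (2 * (1 - p) * (1 + \<omega>) / (p * real r))))" "\<gamma> \<le> p / (2 * \<mu>)"
begin

abbreviation "f \<equiv> average n F"

definition lyapunov :: "'d marina_state \<Rightarrow> real" where
  "lyapunov = (\<lambda>(x, g, _). f x - f xs + \<gamma> / p * (norm (g - grad f x))\<^sup>2)"

lemma f_ge: "f xs \<le> f x"
  using pl unfolding polyak_lojasiewicz_def by (simp add: is_arg_min_linorder)

lemma smooth_f: "L_smooth L f"
  unfolding L_eq by (rule L_smooth_average[OF smooth])

lemma L_nonneg: "0 \<le> L"
  unfolding L_eq by (simp add: sum_nonneg)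

lemma grad_f: "grad f x = (1 / real n) *\<^sub>R (\<Sum>i = 1..n. grad (F i) x)"
  by (intro GDERIV_imp_grad_eq GDERIV_average L_smooth_GDERIV_grad[OF smooth])

lemma measurable_f [measurable]: "f \<in> borel_measurable borel"
  using L_smooth_continuous[OF smooth_f] by (rule borel_measurable_continuous_onI)

lemma measurable_lyapunov [measurable]: "lyapunov \<in> borel_measurable marina_space"
  unfolding lyapunov_def marina_space_def case_prod_beta by measurable

lemma lyapunov_ge: "f (fst s) - f xs \<le> lyapunov s" "0 \<le> lyapunov s"
  using f_ge stepsize_pos p_pos by (auto simp: lyapunov_def split: prod.split)

text \<open>The mean of the messages is exactly the change of the gradient, so the old error
  survives unchanged and only a variance is added. Averaging \<open>r\<close> independent messages
  divides that variance by \<open>r\<close>.\<close>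

lemma nn_integral_messages_error:
  assumes s: "s = (x, g, u, q, z)"
  shows "(\<integral>\<^sup>+t. ennreal ((norm (g + (1 / real r) *\<^sub>R fst t - grad f (x - \<gamma> *\<^sub>R g)))\<^sup>2) \<partial>messages s)
    \<le> ennreal ((norm (g - grad f x))\<^sup>2 + (1 + \<omega>) / real r * L\<^sup>2 * (norm (\<gamma> *\<^sub>R g))\<^sup>2)"
proof -
  let ?x' = "x - \<gamma> *\<^sub>R g"
  define v where "v i = grad (F i) ?x' - grad (F i) x" for i
  define m where "m = (1 / real n) *\<^sub>R (\<Sum>i = 1..n. v i)"
  define W where "W = (1 + \<omega>) / real n * (\<Sum>i = 1..n. (norm (v i))\<^sup>2)"
  have om: "0 < \<omega>" using quantizer unfolding quantization_operator_def by simp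
  have m_eq: "m = grad f ?x' - grad f x"
    by (simp add: m_def v_def grad_f sum_subtractf scaleR_diff_right)
  have "(\<Sum>i = 1..n. (norm (v i))\<^sup>2) \<le> (\<Sum>i = 1..n. (Li i)\<^sup>2) * (norm (?x' - x))\<^sup>2"
    unfolding v_def by (rule sum_norm_grad_diff_le[of n Li F, OF smooth])
  also have "(\<Sum>i = 1..n. (Li i)\<^sup>2) = real n * L\<^sup>2"
    using n_pos by (simp add: L_eq sum_nonneg)
  finally have "W \<le> (1 + \<omega>) / real n * (real n * L\<^sup>2 * (norm (\<gamma> *\<^sub>R g))\<^sup>2)"
    unfolding W_def using om by (intro mult_left_mono) auto
  then have W: "W \<le> (1 + \<omega>) * L\<^sup>2 * (norm (\<gamma> *\<^sub>R g))\<^sup>2"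
    using n_pos by simp
  \<comment> \<open>Scaling by \<open>r\<close> gives the shape of
    \<open>quantized_sum_second_moment\<close> with offset \<open>r\<close> times the old error. The
    factor \<open>(1 / real r)\<^sup>2\<close> then meets a variance linear in
    \<open>r\<close>.\<close>
  have eq: "(norm (g + (1 / real r) *\<^sub>R t - grad f ?x'))\<^sup>2
      = (1 / real r)\<^sup>2 * (norm (real r *\<^sub>R (g - grad f x) + t - real r *\<^sub>R m))\<^sup>2" for t
  proof -
    have "g + (1 / real r) *\<^sub>R t - grad f ?x' = (1 / real r) *\<^sub>R (real r *\<^sub>R (g - grad f x) + t - real r *\<^sub>R m)"
      using r_pos by (simp add: m_eq algebra_simps)
    then show ?thesis by (simp only: norm_scaleR power_mult_distrib power2_abs)
  qed
  have ms: "messages s = quantized_sum Q n v r"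
    by (simp add: s messages_def v_def[abs_def])
  note [measurable_cong] = messages_prob(2)[of s]
  have "(\<integral>\<^sup>+t. ennreal ((norm (g + (1 / real r) *\<^sub>R fst t - grad f ?x'))\<^sup>2) \<partial>messages s)
      = ennreal ((1 / real r)\<^sup>2) * (\<integral>\<^sup>+t. ennreal ((norm (real r *\<^sub>R (g - grad f x) + fst t - real r *\<^sub>R m))\<^sup>2) \<partial>messages s)"
    unfolding eq by (subst nn_integral_cmult[symmetric], measurable) (simp add: ennreal_mult)
  also have "\<dots> \<le> ennreal ((1 / real r)\<^sup>2) * ennreal ((norm (real r *\<^sub>R (g - grad f x)))\<^sup>2 + real r * W)"
    unfolding W_def ms by (intro mult_left_mono quantized_sum_second_moment quantizer n_pos m_def) simp
  also have "\<dots> = ennreal ((1 / real r)\<^sup>2 * ((norm (real r *\<^sub>R (g - grad f x)))\<^sup>2 + real r * W))"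
    by (rule ennreal_mult'[symmetric]) simp
  also have "(1 / real r)\<^sup>2 * ((norm (real r *\<^sub>R (g - grad f x)))\<^sup>2 + real r * W)
      = (norm (g - grad f x))\<^sup>2 + W / real r"
    unfolding norm_scaleR power_mult_distrib using r_pos by (simp add: power2_eq_square field_simps)
  also have "ennreal ((norm (g - grad f x))\<^sup>2 + W / real r)
      \<le> ennreal ((norm (g - grad f x))\<^sup>2 + (1 + \<omega>) / real r * L\<^sup>2 * (norm (\<gamma> *\<^sub>R g))\<^sup>2)"
    using divide_right_mono[OF W, of "real r"] by (intro ennreal_leI) simp
  finally show ?thesis .
qed

lemma nn_integral_step_lyapunov:
  "(\<integral>\<^sup>+s'. ennreal (lyapunov s') \<partial>step s) \<le> ennreal (1 - \<gamma> * \<mu>) * ennreal (lyapunov s)"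
proof -
  obtain x g u q z where s: "s = (x, g, u, q, z)" by (cases s)
  let ?x' = "x - \<gamma> *\<^sub>R g"
  define e where "e = (norm (g - grad f x))\<^sup>2 + (1 + \<omega>) / real r * L\<^sup>2 * (norm (\<gamma> *\<^sub>R g))\<^sup>2"
  define a where "a = f ?x' - f xs"
  have om: "0 < \<omega>" using quantizer unfolding quantization_operator_def by simp
  have a0: "0 \<le> a" and e0: "0 \<le> e" and k0: "0 \<le> \<gamma> / p"
    using f_ge om stepsize_pos p_pos by (auto simp: a_def e_def)
  \<comment> \<open>After a full round the estimator is the exact gradient, so the error term
    vanishes.\<close>
  have full: "lyapunov (full_update s) = a"
    by (simp add: s full_update_def lyapunov_def Let_def a_def)
  note [measurable_cong] = messages_prob(2)[of s]
  have "(\<integral>\<^sup>+t. ennreal (lyapunov (quantized_update s t)) \<partial>messages s)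
      = (\<integral>\<^sup>+t. ennreal (\<gamma> / p) * ennreal ((norm (g + (1 / real r) *\<^sub>R fst t - grad f ?x'))\<^sup>2) + ennreal a \<partial>messages s)"
  proof (intro nn_integral_cong)
    fix t :: "(real ^ 'd) \<times> nat"
    let ?N = "(norm (g + (1 / real r) *\<^sub>R fst t - grad f ?x'))\<^sup>2"
    have "lyapunov (quantized_update s t) = \<gamma> / p * ?N + a"
      by (simp add: s quantized_update_def lyapunov_def a_def case_prod_beta)
    also have "ennreal \<dots> = ennreal (\<gamma> / p * ?N) + ennreal a"
      using a0 k0 by (intro ennreal_plus mult_nonneg_nonneg) auto
    also have "ennreal (\<gamma> / p * ?N) = ennreal (\<gamma> / p) * ennreal ?N"
      using k0 by (intro ennreal_mult) auto
    finally show "ennreal (lyapunov (quantized_update s t)) = ennreal (\<gamma> / p) * ennreal ?N + ennreal a" .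
  qed
  also have "\<dots> = ennreal (\<gamma> / p) * (\<integral>\<^sup>+t. ennreal ((norm (g + (1 / real r) *\<^sub>R fst t - grad f ?x'))\<^sup>2) \<partial>messages s) + ennreal a"
    by (subst nn_integral_add_const[OF messages_prob(1)], measurable, subst nn_integral_cmult, measurable)
  also have "\<dots> \<le> ennreal (\<gamma> / p) * ennreal e + ennreal a"
    unfolding e_def by (intro add_right_mono mult_left_mono nn_integral_messages_error[OF s]) simp
  finally have quant: "(\<integral>\<^sup>+t. ennreal (lyapunov (quantized_update s t)) \<partial>messages s)
      \<le> ennreal (\<gamma> / p) * ennreal e + ennreal a" .
  have "(\<integral>\<^sup>+s'. ennreal (lyapunov s') \<partial>step s)
      \<le> ennreal p * ennreal a + ennreal (1 - p) * (ennreal (\<gamma> / p) * ennreal e + ennreal a)"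
    by (subst nn_integral_step) (auto simp: full intro!: add_left_mono mult_left_mono quant)
  also have "\<dots> = ennreal (p * a + (1 - p) * (\<gamma> / p * e + a))"
    using p_pos p_le_1 a0 e0 k0 by (simp flip: ennreal_plus ennreal_mult del: times_divide_eq_left)
  also have "p * a + (1 - p) * (\<gamma> / p * e + a) = a + \<gamma> / p * (1 - p) * e"
    by (simp add: algebra_simps)
  \<comment> \<open>The contraction is applied with
    \<open>c = (1 + \<omega>) / real r\<close>.\<close>
  also have "\<dots> \<le> (1 - \<gamma> * \<mu>) * (f x - f xs + \<gamma> / p * (norm (g - grad f x))\<^sup>2)"
    unfolding a_def e_def
    using stepsize om by (intro lyapunov_contraction[OF smooth_f L_nonneg pl p_pos p_le_1 _ stepsize_pos])
      (auto simp: mult.commute)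
  also have "f x - f xs + \<gamma> / p * (norm (g - grad f x))\<^sup>2 = lyapunov s"
    by (simp add: s lyapunov_def)
  finally show ?thesis using lyapunov_ge(2) by (simp add: ennreal_leI ennreal_mult'')
qed

text \<open>Lets powers of the factor pass between \<open>ennreal\<close> and the reals, and permits
  \<open>power_mono\<close> in the complexity estimate.\<close>

lemma contraction_factor: "0 \<le> 1 - \<gamma> * \<mu>"
proof -
  have "\<mu> > 0" using pl unfolding polyak_lojasiewicz_def by simp
  then have "\<gamma> * \<mu> \<le> p / 2" using stepsize(2) by (simp add: field_simps)
  then show ?thesis using p_le_1 by simp
qed

lemma convergence:
  shows "integrable (law x0 K) (\<lambda>s. f (fst s) - f xs)"
    and "(\<integral>s. f (fst s) - f xs \<partial>law x0 K) \<le> (1 - \<gamma> * \<mu>) ^ K * (f x0 - f xs)"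
proof -
  let ?B = "(1 - \<gamma> * \<mu>) ^ K * (f x0 - f xs)"
  have B0: "0 \<le> ?B" using contraction_factor f_ge by simp
  have m: "(\<lambda>s. f (fst s) - f xs) \<in> borel_measurable (law x0 K)"
    unfolding measurable_cong_sets[OF law_prob(2) refl] marina_space_def by measurable
  have nn: "0 \<le> f (fst s) - f xs" for s :: "'d marina_state" using f_ge by simp
  have "(\<integral>\<^sup>+s. ennreal (f (fst s) - f xs) \<partial>law x0 K) \<le> (\<integral>\<^sup>+s. ennreal (lyapunov s) \<partial>law x0 K)"
    by (intro nn_integral_mono ennreal_leI lyapunov_ge)
  also have "\<dots> \<le> ennreal (1 - \<gamma> * \<mu>) ^ K
      * ennreal (lyapunov (x0, grad f x0, n, 0, \<Sum>i = 1..n. l0 (grad (F i) x0)))"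
    by (intro nn_integral_law_geometric nn_integral_step_lyapunov) measurable
  \<comment> \<open>The method starts with the exact gradient, so the initial Lyapunov value is just
    the initial function gap.\<close>
  also have "\<dots> = ennreal ?B"
    using contraction_factor f_ge by (simp add: lyapunov_def ennreal_power flip: ennreal_mult)
  finally have le: "(\<integral>\<^sup>+s. ennreal (f (fst s) - f xs) \<partial>law x0 K) \<le> ennreal ?B" .
  then show int: "integrable (law x0 K) (\<lambda>s. f (fst s) - f xs)"
    by (intro integrableI_nonneg m AE_I2 nn) (auto intro: order.strict_trans1)
  show "(\<integral>s. f (fst s) - f xs \<partial>law x0 K) \<le> ?B"
    using le B0 unfolding nn_integral_eq_integral[OF int AE_I2[OF nn]]
    by (subst (asm) ennreal_le_iff) auto
qed

end

text \<open>The O-claims are given the explicit constant 4. The range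
  \<open>\<epsilon> \<le> \<Delta>0 / 2\<close> keeps the logarithm at least \<open>ln 2\<close>, so
  that rounding \<open>K\<close> up to an integer is absorbed by the constant.\<close>

theorem theoremE2:
  fixes F :: "nat \<Rightarrow> real ^ 'd \<Rightarrow> real" and f :: "real ^ 'd \<Rightarrow> real"
    and Q :: "real ^ 'd \<Rightarrow> (real ^ 'd) measure"
    and x0 xs :: "real ^ 'd"
    and n r :: nat
    and Li :: "nat \<Rightarrow> real"
    and L f_low \<mu> \<omega> p \<gamma>_max \<zeta> d \<Delta>0 M :: real
  assumes "f = average n F"
    and "\<And>x. f x \<ge> f_low"
    and "\<And>i. i \<in> {1..n} \<Longrightarrow> L_smooth (Li i) (F i)"
    and "polyak_lojasiewicz \<mu> f xs"
    and "quantization_operator \<omega> Q"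
    and "0 < p" and "p \<le> 1"
    and "1 \<le> r" and "r \<le> n"
    and "L = sqrt ((1 / real n) * (\<Sum>i = 1..n. (Li i)\<^sup>2))"
    and "\<gamma>_max = min (1 / (L * (1 + sqrt (2 * (1 - p) * (1 + \<omega>) / (p * real r))))) (p / (2 * \<mu>))"
    and "M = max (1 / p) (L / \<mu> * (1 + sqrt ((1 - p) * (1 + \<omega>) / (p * real r))))"
    and "\<Delta>0 = f x0 - f xs"
    and "d = real CARD('d)"
    and "\<zeta> = expected_density Q"
  shows
    "(\<forall>\<gamma> K. 0 < \<gamma> \<and> \<gamma> \<le> \<gamma>_max \<longrightarrow>
        (let P = pp_marina Q F n r p \<gamma> x0 K; cost = d * n + K * (p * d * n + (1 - p) * \<zeta> * r) in
          integrable P (\<lambda>s. f (fst s) - f xs) \<and>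
          (\<integral>s. f (fst s) - f xs \<partial>P) \<le> (1 - \<gamma> * \<mu>) ^ K * \<Delta>0 \<and>
          integrable P (charged_cost Q) \<and>
          (\<integral>s. charged_cost Q s \<partial>P) = cost \<and>
          integrable P nonzero_cost \<and>
          (\<integral>s. nonzero_cost s \<partial>P) \<le> cost \<and>
          (density_attained Q F n r p \<gamma> x0 K \<longrightarrow> (\<integral>s. nonzero_cost s \<partial>P) = cost))) \<and>
     (\<forall>\<epsilon>. 0 < \<epsilon> \<and> \<epsilon> \<le> \<Delta>0 / 2 \<longrightarrow>
        (\<exists>K::nat.
          real K \<le> 4 * (M * ln (\<Delta>0 / \<epsilon>)) \<and>
          integrable (pp_marina Q F n r p \<gamma>_max x0 K) (\<lambda>s. f (fst s) - f xs) \<and>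
          (\<integral>s. f (fst s) - f xs \<partial>pp_marina Q F n r p \<gamma>_max x0 K) \<le> \<epsilon> \<and>
          d * n + K * (p * d * n + (1 - p) * \<zeta> * r)
            \<le> 4 * (d * n + M * (p * d * n + (1 - p) * \<zeta> * r) * ln (\<Delta>0 / \<epsilon>))))"
proof -
  have mu: "0 < \<mu>" using assms(4) unfolding polyak_lojasiewicz_def by simp
  have om: "0 < \<omega>" and Qk: "Q \<in> borel \<rightarrow>\<^sub>M prob_algebra borel"
    using assms(5) unfolding quantization_operator_def by auto
  have n: "1 \<le> n" using assms(8,9) by simp
  have L_smooth_f: "L_smooth L f"
    unfolding assms(1,10) by (rule L_smooth_average[OF assms(3)])
  have L0: "0 \<le> L" unfolding assms(10) by (simp add: sum_nonneg)
  \<comment> \<open>The locale predicate has no stepsize argument, so this one fact serves all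
    \<open>\<gamma>\<close>.\<close>
  have kernel: "pp_marina_kernel Q F n r p"
  proof
    show "grad (average n F) \<in> borel_measurable borel"
      using L_smooth_continuous_grad[OF L_smooth_f] assms(1) by (simp add: borel_measurable_continuous_onI)
    show "grad (F i) \<in> borel_measurable borel" if "i \<in> {1..n}" for i
      using L_smooth_continuous_grad[OF assms(3)[OF that]] by (rule borel_measurable_continuous_onI)
  qed (rule Qk n assms(6-8))+
  have conv: "integrable (pp_marina Q F n r p \<gamma> x0 K) (\<lambda>s. f (fst s) - f xs)"
    "(\<integral>s. f (fst s) - f xs \<partial>pp_marina Q F n r p \<gamma> x0 K) \<le> (1 - \<gamma> * \<mu>) ^ K * \<Delta>0"
    "0 \<le> 1 - \<gamma> * \<mu>"
    if "0 < \<gamma>" "\<gamma> \<le> \<gamma>_max" for \<gamma> K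
  proof -
    interpret PL: pp_marina_pl Q F n r p \<gamma> \<omega> \<mu> L Li xs
    proof (intro pp_marina_pl.intro pp_marina_pl_axioms.intro kernel)
      show "polyak_lojasiewicz \<mu> (average n F) xs" using assms(4) unfolding assms(1) .
      show "\<gamma> \<le> 1 / (L * (1 + sqrt (2 * (1 - p) * (1 + \<omega>) / (p * real r))))" "\<gamma> \<le> p / (2 * \<mu>)"
        using that(2) unfolding assms(11) by linarith+
    qed (rule assms(3,5,10) that(1) | assumption)+
    show "integrable (pp_marina Q F n r p \<gamma> x0 K) (\<lambda>s. f (fst s) - f xs)"
      "(\<integral>s. f (fst s) - f xs \<partial>pp_marina Q F n r p \<gamma> x0 K) \<le> (1 - \<gamma> * \<mu>) ^ K * \<Delta>0"
      "0 \<le> 1 - \<gamma> * \<mu>"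
      unfolding assms(1,13) by (fact PL.convergence PL.contraction_factor)+
  qed
  have part1: "let P = pp_marina Q F n r p \<gamma> x0 K; cost = d * n + K * (p * d * n + (1 - p) * \<zeta> * r) in
          integrable P (\<lambda>s. f (fst s) - f xs) \<and>
          (\<integral>s. f (fst s) - f xs \<partial>P) \<le> (1 - \<gamma> * \<mu>) ^ K * \<Delta>0 \<and>
          integrable P (charged_cost Q) \<and>
          (\<integral>s. charged_cost Q s \<partial>P) = cost \<and>
          integrable P nonzero_cost \<and>
          (\<integral>s. nonzero_cost s \<partial>P) \<le> cost \<and>
          (density_attained Q F n r p \<gamma> x0 K \<longrightarrow> (\<integral>s. nonzero_cost s \<partial>P) = cost)"
    if "0 < \<gamma> \<and> \<gamma> \<le> \<gamma>_max" for \<gamma> K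
    using conv(1,2)[of \<gamma> K] that pp_marina_kernel.charged_cost_law[OF kernel, of \<gamma> x0 K]
      pp_marina_kernel.nonzero_cost_law[OF kernel, of \<gamma> x0 K]
    unfolding assms(14,15) Let_def by (auto simp: has_bochner_integral_iff)
  have part2: "\<exists>K::nat.
          real K \<le> 4 * (M * ln (\<Delta>0 / \<epsilon>)) \<and>
          integrable (pp_marina Q F n r p \<gamma>_max x0 K) (\<lambda>s. f (fst s) - f xs) \<and>
          (\<integral>s. f (fst s) - f xs \<partial>pp_marina Q F n r p \<gamma>_max x0 K) \<le> \<epsilon> \<and>
          d * n + K * (p * d * n + (1 - p) * \<zeta> * r)
            \<le> 4 * (d * n + M * (p * d * n + (1 - p) * \<zeta> * r) * ln (\<Delta>0 / \<epsilon>))"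
    if eps: "0 < \<epsilon>" "\<epsilon> \<le> \<Delta>0 / 2" for \<epsilon>
  proof -
    have D0: "0 < \<Delta>0" using eps by simp
    \<comment> \<open>For \<open>L = 0\<close> the gradient would be constant, hence zero as at the
      minimizer, and the Polyak-Lojasiewicz inequality would force \<open>\<Delta>0 \<le> 0\<close>.
      Moreover \<open>1 / 0 = 0\<close> would make the maximal stepsize zero.\<close>
    have "L \<noteq> 0"
    proof
      assume "L = 0"
      then have "grad f x0 = grad f xs"
        using L_smooth_norm_grad_diff[OF L_smooth_f, of x0 xs] by simp
      also have "\<dots> = 0"
        using L_smooth_f assms(4) unfolding L_smooth_def polyak_lojasiewicz_def
        by (intro grad_arg_min_eq_0) auto
      finally have "2 * \<mu> * \<Delta>0 \<le> 0"
        using assms(4) unfolding polyak_lojasiewicz_def assms(13) by (metis norm_zero zero_power2)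
      then show False using mu D0 by (simp add: mult_le_0_iff)
    qed
    with L0 have L: "0 < L" by simp
    define A where "A = (1 - p) * (1 + \<omega>) / (p * real r)"
    have A0: "0 \<le> A" using assms(6,7) om by (simp add: A_def)
    define R where "R = L * (1 + sqrt (2 * A))"
    have R0: "0 < R" using L A0 by (simp add: R_def add_pos_nonneg)
    have gm: "\<gamma>_max = min (1 / R) (p / (2 * \<mu>))"
      by (simp only: assms(11) R_def A_def mult.assoc times_divide_eq_right)
    have gm0: "0 < \<gamma>_max" using R0 mu assms(6) by (simp add: gm)
    have Mp: "1 / p \<le> M" and MR: "R / \<mu> \<le> 2 * M"
    proof -
      show "1 / p \<le> M" by (simp add: assms(12))
      \<comment> \<open>The stepsize has \<open>2 * A\<close> under the root where \<open>M\<close>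
        has \<open>A\<close>; the discrepancy costs at most a factor 2.\<close>
      have "sqrt 2 \<le> 2" by (rule real_le_lsqrt) auto
      then have "sqrt 2 * sqrt A \<le> 2 * sqrt A" using A0 by (intro mult_right_mono) auto
      then have "1 + sqrt (2 * A) \<le> 2 * (1 + sqrt A)" by (simp add: real_sqrt_mult)
      then have "L / \<mu> * (1 + sqrt (2 * A)) \<le> L / \<mu> * (2 * (1 + sqrt A))"
        using L mu by (intro mult_left_mono) auto
      also have "\<dots> = 2 * (L / \<mu> * (1 + sqrt A))" by simp
      also have "\<dots> \<le> 2 * M" unfolding assms(12) A_def by (intro mult_left_mono max.cobounded2) simp
      finally show "R / \<mu> \<le> 2 * M" by (simp add: R_def)
    qed
    have "1 \<le> 1 / p" using assms(6,7) by simp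
    with Mp have M1: "1 \<le> M" by simp
    \<comment> \<open>The left-hand side is the larger of \<open>R / \<mu>\<close> and
      \<open>2 / p\<close>, and each of these is at most \<open>2 * M\<close>.\<close>
    have gmM: "1 / (\<gamma>_max * \<mu>) \<le> 2 * M"
      using MR Mp mu assms(6) R0 by (auto simp: gm min_def field_simps)
    define l where "l = ln (\<Delta>0 / \<epsilon>)"
    have "ln 2 \<le> l"
      using eps D0 by (simp add: l_def field_simps)
    with ln2_ge_two_thirds have l: "2 / 3 \<le> l" by simp
    define K where "K = nat \<lceil>l / (\<gamma>_max * \<mu>)\<rceil>"
    have gmu0: "0 < \<gamma>_max * \<mu>" using gm0 mu by simp
    have K_ge: "l / (\<gamma>_max * \<mu>) \<le> real K"
      unfolding K_def by (rule real_nat_ceiling_ge)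
    have "0 \<le> l / (\<gamma>_max * \<mu>)" using l gmu0 by simp
    then have "real K \<le> l / (\<gamma>_max * \<mu>) + 1"
      unfolding K_def by linarith
    also have "l / (\<gamma>_max * \<mu>) = l * (1 / (\<gamma>_max * \<mu>))" by simp
    also have "\<dots> \<le> l * (2 * M)" using gmM l by (intro mult_left_mono) auto
    \<comment> \<open>This absorbs the 1 lost to the ceiling: with \<open>l \<ge> 2 / 3\<close> and
      \<open>M \<ge> 1\<close> the product is at least 4/3. Together with the main part it makes up
      the constant 4.\<close>
    also have "1 \<le> l * (2 * M)"
    proof -
      have "2 / 3 * 1 \<le> l * M" using l M1 by (intro mult_mono) auto
      moreover have "l * (2 * M) = 2 * (l * M)" by simp
      ultimately show ?thesis by linarith
    qed
    finally have K_le: "real K \<le> 4 * (M * l)" by simp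
    \<comment> \<open>The usual estimate of 1 - t by \<open>exp (- t)\<close>; \<open>K\<close> was
      chosen so that the exponent reaches \<open>- l\<close>, and \<open>exp (- l)\<close> is the
      required ratio of \<open>\<epsilon>\<close> to \<open>\<Delta>0\<close>.\<close>
    have "(1 - \<gamma>_max * \<mu>) ^ K \<le> exp (- (\<gamma>_max * \<mu>)) ^ K"
      using conv(3)[OF gm0 order_refl] exp_ge_add_one_self[of "- (\<gamma>_max * \<mu>)"] by (intro power_mono) auto
    also have "\<dots> = exp (- (real K * (\<gamma>_max * \<mu>)))"
      by (simp flip: exp_of_nat_mult)
    also have "\<dots> \<le> exp (- l)" using K_ge gmu0 by (simp add: field_simps)
    also have "\<dots> = \<epsilon> / \<Delta>0" using eps D0 by (simp add: l_def exp_minus)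
    finally have "(1 - \<gamma>_max * \<mu>) ^ K * \<Delta>0 \<le> \<epsilon>" using D0 by (simp add: field_simps)
    then have fin: "(\<integral>s. f (fst s) - f xs \<partial>pp_marina Q F n r p \<gamma>_max x0 K) \<le> \<epsilon>"
      using conv(2)[OF gm0 order_refl, of K] by simp
    have c0: "0 \<le> p * d * n + (1 - p) * \<zeta> * r" (is "0 \<le> ?c")
      using assms(6,7,14,15) pp_marina_kernel.expected_density_nonneg[OF kernel] by simp
    have "real K * ?c \<le> 4 * (M * l) * ?c" using K_le c0 by (rule mult_right_mono)
    moreover have "0 \<le> d * n" by (simp add: assms(14))
    ultimately have "d * n + K * ?c \<le> 4 * (d * n + M * ?c * l)" by (simp add: algebra_simps)
    then show ?thesis
      using K_le fin conv(1)[OF gm0 order_refl] unfolding l_def by blast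
  qed
  show ?thesis using part1 part2 by blast
qed

end
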